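(* In the semi-random graph process, let $\alpha>0$ be a constant and let $\mathcal{P}$ be an $n^\alpha$-edge-replaceable, linear, monotone increasing property satisfying the following for some constant $\delta\in(0,1)$: (1) for each $i\in[n]$, if $G_0$ is any graph on $[n]$ such that the induced graphs $G_0[\{1,\dots,i\}]$ and $G_0[\{i+1,\dots,n\}]$ each satisfy $\mathcal{P}$, then there is a strategy starting from $G_0$ that satisfies $\mathcal{P}$ after $n^\delta$ steps in expectation; (2) $|I_n-I_{n+1}|<n^\delta$. Then the limit $\lim_{n\to\infty}I_n/n=:C$ exists, and $Cn$ is a sharp threshold for $\mathcal{P}$.
   Context: Semi-random graph process: start with the empty graph on $[n]$ (unless another initial graph $G_0$ is given); in each step a vertex $u_t$ (square) is drawn independently and uniformly at random from $[n]$, the player adaptively chooses a vertex $v_t$ (circle), and the edge $u_tv_t$ is added (multigraphs allowed). A property $\mathcal{P}$ is defined for graphs on any vertex set. For a strategy $\mathcal{S}_n$, $T_{\mathcal{S}_n}$ is the first step at which the graph satisfies $\mathcal{P}$. $I_n:=\min_{\mathcal{S}_n}\mathbb{E}T_{\mathcal{S}_n}$ over all strategies on $[n]$; $\mathcal{P}$ is linear if $I_n=\Theta(n)$. $m_{\mathcal{P}}(\theta,n)$ is the minimum $t\ge1$ such that some strategy has $\Pr[T\le t]\ge\theta$ and every strategy has $\Pr[T\le t-1]<\theta$; $m^*:=m_{\mathcal{P}}(1/2,n)$. $\mathcal{P}$ is $\omega$-edge-replaceable if for any $G\in\mathcal{P}$ and $e\in E(G)$, starting from $G-e$ there is a strategy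 constructing some $G'\in\mathcal{P}$ within $\sqrt{m^*}/\omega$ steps with probability at least $1-o(1/\sqrt{m^*})$. A function $s(n)$ is a sharp threshold if for every $\epsilon>0$: some strategy $\mathcal{S}'_n$ has $\Pr[T_{\mathcal{S}'_n}\le(1+\epsilon)s]=1-o(1)$, and every strategy $\mathcal{S}_n$ has $\Pr[T_{\mathcal{S}_n}\le(1-\epsilon)s]=o(1)$. *)

theory Defs
  imports "HOL-Probability.Probability" "HOL-Library.Landau_Symbols" "HOL-Library.Uprod"
begin

text \<open>A (multi)graph is given by its vertex set and the multiset of its edges; an edge is an
  unordered pair \<open>Upair u v\<close>, and loops are permitted because the player may pick any vertex.\<close>

type_synonym edges = "nat uprod multiset"

type_synonym property = "nat set \<Rightarrow> edges \<Rightarrow> bool"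

definition mgraph :: "nat set \<Rightarrow> edges \<Rightarrow> bool" where
  "mgraph V E \<longleftrightarrow> finite V \<and> (\<forall>e\<in>#E. set_uprod e \<subseteq> V)"

definition induced :: "edges \<Rightarrow> nat set \<Rightarrow> edges" where
  "induced E U = filter_mset (\<lambda>e. set_uprod e \<subseteq> U) E"

text \<open>A property is defined for graphs on any vertex set; as usual for graph properties, it must not
  depend on the names of the vertices. This is what relates the graphs on \<open>{i+1..n}\<close> that satisfy
  the property to those on \<open>{1..n-i}\<close>.\<close>

definition graph_property :: "property \<Rightarrow> bool" where
  "graph_property P \<longleftrightarrow>
     (\<forall>V E W f. mgraph V E \<and> bij_betw f V W \<longrightarrow> P W (image_mset (map_uprod f) E) = P V E)"

definition monotone_increasing :: "property \<Rightarrow> bool" where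
  "monotone_increasing P \<longleftrightarrow>
     (\<forall>V E E'. mgraph V E' \<and> E \<subseteq># E' \<and> P V E \<longrightarrow> P V E')"

text \<open>The sequence of squares; the square of step \<open>t \<ge> 1\<close> is the coordinate \<open>t - 1\<close>.\<close>

definition squares :: "nat \<Rightarrow> (nat \<Rightarrow> nat) measure" where
  "squares n = (\<Pi>\<^sub>M t\<in>UNIV. measure_pmf (pmf_of_set {1..n}))"

text \<open>An adaptive strategy maps the squares \<open>[u\<^sub>1, \<dots>, u\<^sub>t]\<close> offered so far, including the current
  one, to the circle \<open>v\<^sub>t\<close>. The earlier circles, and thus the current graph, are determined by the
  strategy and these squares, so they need not be arguments.\<close>

type_synonym strategy = "nat list \<Rightarrow> nat"

definition strategies :: "nat \<Rightarrow> strategy set" where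
  "strategies n = {S. \<forall>us. us \<noteq> [] \<and> set us \<subseteq> {1..n} \<longrightarrow> S us \<in> {1..n}}"

primrec process :: "edges \<Rightarrow> strategy \<Rightarrow> (nat \<Rightarrow> nat) \<Rightarrow> nat \<Rightarrow> edges" where
  "process G0 S u 0 = G0"
| "process G0 S u (Suc t) =
     add_mset (Upair (u t) (S (map u [0..<Suc t]))) (process G0 S u t)"

text \<open>The first step at which the property holds (\<open>\<infinity>\<close> if there is none).\<close>

definition hitting_time :: "property \<Rightarrow> nat \<Rightarrow> edges \<Rightarrow> strategy \<Rightarrow> (nat \<Rightarrow> nat) \<Rightarrow> enat" where
  "hitting_time P n G0 S u = (INF t\<in>{t. P {1..n} (process G0 S u t)}. enat t)"

definition expected_time :: "property \<Rightarrow> nat \<Rightarrow> edges \<Rightarrow> strategy \<Rightarrow> ennreal" where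
  "expected_time P n G0 S = (\<integral>\<^sup>+ u. ennreal_of_enat (hitting_time P n G0 S u) \<partial>squares n)"

definition prob_within :: "property \<Rightarrow> nat \<Rightarrow> edges \<Rightarrow> strategy \<Rightarrow> real \<Rightarrow> real" where
  "prob_within P n G0 S x =
     \<P>(u in squares n. ereal_of_enat (hitting_time P n G0 S u) \<le> ereal x)"

definition optimal_time :: "property \<Rightarrow> nat \<Rightarrow> ennreal" where
  "optimal_time P n = (INF S\<in>strategies n. expected_time P n {#} S)"

text \<open>Since \<open>enn2real \<infinity> = 0\<close>, the lower bound in \<open>\<Theta>\<close> forces \<open>optimal_time P n < \<infinity>\<close> for
  all large \<open>n\<close>.\<close>

definition linear_property :: "property \<Rightarrow> bool" where
  "linear_property P \<longleftrightarrow> (\<lambda>n. enn2real (optimal_time P n)) \<in> \<Theta>(\<lambda>n. real n)"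

definition quantile_time :: "property \<Rightarrow> real \<Rightarrow> nat \<Rightarrow> nat" where
  "quantile_time P \<theta> n = (LEAST t. 1 \<le> t \<and>
     (\<exists>S\<in>strategies n. prob_within P n {#} S (real t) \<ge> \<theta>) \<and>
     (\<forall>S\<in>strategies n. prob_within P n {#} S (real t - 1) < \<theta>))"

abbreviation median_time :: "property \<Rightarrow> nat \<Rightarrow> nat" where
  "median_time P n \<equiv> quantile_time P (1/2) n"

text \<open>The error \<open>err n = o(1/sqrt m*)\<close> is uniform over all graphs on \<open>{1..n}\<close> and their edges.\<close>

definition edge_replaceable :: "(nat \<Rightarrow> real) \<Rightarrow> property \<Rightarrow> bool" where
  "edge_replaceable \<omega> P \<longleftrightarrow>
     (\<exists>err :: nat \<Rightarrow> real. err \<in> o(\<lambda>n. 1 / sqrt (real (median_time P n))) \<and>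
       (\<forall>n\<ge>1. \<forall>G. mgraph {1..n} G \<and> P {1..n} G \<longrightarrow>
         (\<forall>e\<in>#G. \<exists>S\<in>strategies n.
            prob_within P n (G - {#e#}) S (sqrt (real (median_time P n)) / \<omega> n) \<ge> 1 - err n)))"

definition sharp_threshold :: "property \<Rightarrow> (nat \<Rightarrow> real) \<Rightarrow> bool" where
  "sharp_threshold P s \<longleftrightarrow> (\<forall>\<epsilon>>0.
     (\<exists>S. (\<forall>n. S n \<in> strategies n) \<and>
        (\<lambda>n. prob_within P n {#} (S n) ((1 + \<epsilon>) * s n)) \<longlonglongrightarrow> 1) \<and>
     (\<forall>S. (\<forall>n. S n \<in> strategies n) \<longrightarrow>
        (\<lambda>n. prob_within P n {#} (S n) ((1 - \<epsilon>) * s n)) \<longlonglongrightarrow> 0))"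

end

theory Submission
  imports Defs "HOL-Real_Asymp.Real_Asymp"
begin

text \<open>
  Dynamic programming gives Bellman equations for the optimal expected remaining time of a graph
  and for the optimal probability of success within \<open>k\<close> steps. Replaceability together with
  monotonicity makes the remaining time Lipschitz: deleting an edge costs at most
  \<open>2 * sqrt m* / n powr \<alpha>\<close> expected steps, because a failed repair may simply be restarted.
  Along an optimal play the remaining time plus the elapsed time is a martingale (along any play a
  submartingale), so Hoeffding's lemma concentrates the hitting time around \<open>I_n\<close> within \<open>o(n)\<close>.

  Splitting \<open>[N]\<close> into blocks of comparable sizes \<open>a\<close> and \<open>b\<close> and answering each square optimally inside its
  own block, both blocks satisfy the property after about \<open>N * max (I_a / a) (I_b / b)\<close> steps, and
  merging them costs \<open>N powr \<delta>\<close> more. Thus \<open>I_N / N \<le> max (I_a / a) (I_b / b) + O(N powr -g)\<close>, and iterated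
  halving bounds \<open>I_N / N\<close> by \<open>I_m / m + o(1)\<close> as \<open>m \<rightarrow> \<infinity>\<close>, for all \<open>N \<ge> m * m\<close>. This forces convergence, and
  concentration turns the limit into a sharp threshold.
\<close>

section \<open>First-step analysis\<close>

text \<open>Concentration works because replaceability beats sqrt n by a polynomial factor. A tilt
  \<open>l\<close> of order \<open>n powr (\<beta> - 1)\<close> turns O(n) steps with increments of
  order \<open>n powr (1/2 - \<beta>)\<close> into a bounded second-order term, while a deviation of
  order n still adds a multiple of \<open>n powr \<beta>\<close> to the exponent. Strategies see
  only squares, and an infimum over them need not be attained. So no martingale is built on the
  space of squares: each tail bound is an induction over the number of steps left, applied to a
  function of the current graph. Halving, rather than attaching blocks of one size one by one, keeps
  the merging errors summable: they form a geometric series dominated by the smallest blocks. The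
  two parts also stay comparable, so the slowdown \<open>N / a\<close> of a block's clock is at most
  6. Blocks of two sizes, m and m + 1, occur because N need not be a multiple of m; this is where
  the smoothness of I_n enters.\<close>

lemma nn_integral_squares_case_nat:
  assumes "n \<ge> 1" and f: "f \<in> borel_measurable (squares n)"
  shows "(\<integral>\<^sup>+ u. f u \<partial>squares n) = (\<Sum>x\<in>{1..n}. \<integral>\<^sup>+ u. f (case_nat x u) \<partial>squares n) / of_nat n"
proof -
  let ?p = "pmf_of_set {1..n}"
  interpret sequence_space "measure_pmf ?p" ..
  have sq: "squares n = S" by (simp add: squares_def)
  have f': "f \<in> borel_measurable S" using f by (simp add: sq)
  have "(\<integral>\<^sup>+ u. f u \<partial>S) = (\<integral>\<^sup>+ u. f u \<partial>distr (measure_pmf ?p \<Otimes>\<^sub>M S) S (\<lambda>(s, \<omega>). case_nat s \<omega>))"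
    by (simp only: PiM_iter)
  also have "\<dots> = (\<integral>\<^sup>+ z. f (case_nat (fst z) (snd z)) \<partial>(measure_pmf ?p \<Otimes>\<^sub>M S))"
    using f' by (subst nn_integral_distr) (auto simp: case_prod_beta)
  also have "\<dots> = (\<integral>\<^sup>+ x. \<integral>\<^sup>+ u. f (case_nat x u) \<partial>S \<partial>?p)"
    using f' by (subst nn_integral_fst[symmetric]) auto
  also have "\<dots> = (\<Sum>x\<in>{1..n}. \<integral>\<^sup>+ u. f (case_nat x u) \<partial>S) / of_nat n"
    using assms(1) by (subst nn_integral_pmf_of_set) auto
  finally show ?thesis by (simp add: sq)
qed

section \<open>Events determined by finitely many squares\<close>

lemma space_squares [simp]: "space (squares n) = UNIV"
  by (simp add: squares_def space_PiM)

lemma prob_space_squares: "prob_space (squares n)"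
  unfolding squares_def by (intro prob_space_PiM prob_space_measure_pmf)

text \<open>Such a function factors through the list of the first \<open>t\<close> squares, which
  takes countably many values, so nothing is asked of its codomain.\<close>

lemma measurable_squares_prefix:
  assumes "\<And>u w. (\<And>i. i < t \<Longrightarrow> u i = w i) \<Longrightarrow> f u = f w"
  shows "f \<in> measurable (squares n) (count_space UNIV)"
proof -
  have 1: "(\<lambda>u. map u [0..<t]) \<in> measurable (squares n) (count_space (UNIV :: nat list set))"
  proof (subst measurable_count_space_eq2_countable, safe)
    fix xs :: "nat list"
    have "map u [0..<t] = xs" if "length xs = t" "\<forall>i<t. u i = xs ! i" for u
      using that by (intro nth_equalityI) auto
    then have "(\<lambda>u. map u [0..<t]) -` {xs} \<inter> space (squares n) = {u \<in> space (squares n). length xs = t \<and> (\<forall>i<t. u i = xs ! i)}"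
      by auto
    also have "\<dots> \<in> sets (squares n)" unfolding squares_def by measurable
    finally show "(\<lambda>u. map u [0..<t]) -` {xs} \<inter> space (squares n) \<in> sets (squares n)" .
  qed auto
  have "f = (\<lambda>xs. f (\<lambda>i. xs ! i)) \<circ> (\<lambda>u. map u [0..<t])"
    by (rule ext) (auto intro!: assms)
  then show ?thesis using measurable_comp[OF 1, of "\<lambda>xs. f (\<lambda>i. xs ! i)" "count_space UNIV"] by simp
qed

text \<open>A strategy is never consulted at the empty list; its value there is arbitrary, and
  strategies built by recursion need to agree only on nonempty lists.\<close>

lemma process_cong:
  assumes "\<And>i. i < t \<Longrightarrow> u i = w i" and "\<And>us. us \<noteq> [] \<Longrightarrow> S us = S' us"
  shows "process G S u t = process G S' w t"
  using assms(1)
proof (induction t)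
  case (Suc t)
  have 1: "map u [0..<Suc t] = map w [0..<Suc t]" using Suc.prems by (intro map_cong) auto
  have 2: "S (map w [0..<Suc t]) = S' (map w [0..<Suc t])" by (rule assms(2)) simp
  show ?case unfolding process.simps 1 2 using Suc by simp
qed simp

lemma process_case_nat:
  "process G S (case_nat x u) (Suc t) =
     process (add_mset (Upair x (S [x])) G) (\<lambda>us. S (x # us)) u t"
proof (induction t)
  case (Suc t)
  have "map (case_nat x u) [0..<Suc (Suc t)] = x # map u [0..<Suc t]"
    by (rule nth_equalityI) (auto simp: nth_Cons less_Suc_eq_0_disj simp del: upt_Suc split: nat.split)
  then show ?case using Suc by (simp del: upt_Suc)
qed simp

lemma hitting_time_le_iff:
  "hitting_time P n G S u \<le> enat k \<longleftrightarrow> (\<exists>t\<le>k. P {1..n} (process G S u t))" (is "?h \<le> _ \<longleftrightarrow> _")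
proof
  assume *: "?h \<le> enat k"
  let ?A = "enat ` {t. P {1..n} (process G S u t)}"
  have "?A \<noteq> {}"
  proof
    assume "?A = {}"
    then have "?h = Inf {}" unfolding hitting_time_def by (rule arg_cong)
    then show False using * by (simp add: Inf_enat_def)
  qed
  then have "Inf ?A \<in> ?A" by (rule wellorder_InfI[OF ex_in_conv[THEN iffD2, THEN someI_ex]])
  then show "\<exists>t\<le>k. P {1..n} (process G S u t)" using * unfolding hitting_time_def by auto
next
  assume "\<exists>t\<le>k. P {1..n} (process G S u t)"
  then obtain t where "t \<le> k" "P {1..n} (process G S u t)" by auto
  then have "?h \<le> enat t" unfolding hitting_time_def by (intro INF_lower) auto
  then show "?h \<le> enat k" using \<open>t \<le> k\<close> by (meson enat_ord_simps(1) order_trans)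
qed

lemma sets_hitting_time_le:
  "{u. \<exists>t\<le>k. P {1..n} (process G S u t)} \<in> sets (squares n)"
proof -
  have "(\<lambda>u. \<exists>t\<le>k. P {1..n} (process G S u t)) \<in> measurable (squares n) (count_space UNIV)"
  proof (rule measurable_squares_prefix[of k])
    fix u w :: "nat \<Rightarrow> nat" assume "\<And>i. i < k \<Longrightarrow> u i = w i"
    then have "process G S u t = process G S w t" if "t \<le> k" for t
      by (intro process_cong) (use that in auto)
    then show "(\<exists>t\<le>k. P {1..n} (process G S u t)) = (\<exists>t\<le>k. P {1..n} (process G S w t))" by auto
  qed
  then have "{u \<in> space (squares n). \<exists>t\<le>k. P {1..n} (process G S u t)} \<in> sets (squares n)"
    by (simp add: pred_def)
  then show ?thesis by simp
qed

lemma prob_within_eq: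
  "prob_within P n G S (real k) = measure (squares n) {u. \<exists>t\<le>k. P {1..n} (process G S u t)}"
proof -
  have "ereal_of_enat h \<le> ereal (real k) \<longleftrightarrow> h \<le> enat k" for h
    by (cases h) auto
  then show ?thesis by (simp add: prob_within_def hitting_time_le_iff)
qed

lemma prob_within_floor:
  assumes "x \<ge> 0" shows "prob_within P n G S x = prob_within P n G S (real (nat \<lfloor>x\<rfloor>))"
proof -
  have "ereal_of_enat h \<le> ereal x \<longleftrightarrow> ereal_of_enat h \<le> ereal (real (nat \<lfloor>x\<rfloor>))" for h
  proof (cases h)
    case (enat m)
    have "real m \<le> x \<longleftrightarrow> m \<le> nat \<lfloor>x\<rfloor>" using assms by (simp add: le_nat_iff le_floor_iff)
    then show ?thesis using enat by simp
  qed simp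
  then show ?thesis unfolding prob_within_def by simp
qed

lemma prob_within_neg: assumes "x < 0" shows "prob_within P n G S x = 0"
proof -
  have "\<not> ereal_of_enat h \<le> ereal x" for h
    using assms by (cases h) auto
  then show ?thesis unfolding prob_within_def by simp
qed

lemma prob_within_0:
  "prob_within P n G S (real 0) = (if P {1..n} G then 1 else 0)"
  using prob_space.prob_space[OF prob_space_squares, of n]
  unfolding prob_within_eq by (simp add: UNIV_def[symmetric])

lemma prob_within_Suc:
  assumes "n \<ge> 1"
  shows "prob_within P n G S (real (Suc k)) = (if P {1..n} G then 1 else
     (\<Sum>x\<in>{1..n}. prob_within P n (add_mset (Upair x (S [x])) G) (\<lambda>us. S (x # us)) (real k)) / real n)"
proof -
  interpret prob_space "squares n" by (rule prob_space_squares)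
  let ?A = "\<lambda>k G S. {u. \<exists>t\<le>k. P {1..n} (process G S u t)}"
  show ?thesis
  proof (cases "P {1..n} G")
    case True
    then have "?A (Suc k) G S = space (squares n)" by (auto intro!: exI[of _ 0])
    then show ?thesis using True by (simp only: prob_within_eq prob_space if_True)
  next
    case False
    have *: "case_nat x u \<in> ?A (Suc k) G S \<longleftrightarrow>
        u \<in> ?A k (add_mset (Upair x (S [x])) G) (\<lambda>us. S (x # us))" for x u
    proof -
      have "(\<exists>t\<le>Suc k. P {1..n} (process G S (case_nat x u) t)) \<longleftrightarrow>
          (\<exists>t\<le>k. P {1..n} (process G S (case_nat x u) (Suc t)))"
        using False by (metis Suc_le_mono not0_implies_Suc process.simps(1))
      then show ?thesis by (simp only: process_case_nat mem_Collect_eq)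
    qed
    have "emeasure (squares n) (?A (Suc k) G S) = (\<integral>\<^sup>+ u. indicator (?A (Suc k) G S) u \<partial>squares n)"
      using sets_hitting_time_le by simp
    also have "\<dots> = (\<Sum>x\<in>{1..n}. \<integral>\<^sup>+ u. indicator (?A (Suc k) G S) (case_nat x u) \<partial>squares n) / of_nat n"
      using assms sets_hitting_time_le by (intro nn_integral_squares_case_nat) auto
    also have "\<dots> = (\<Sum>x\<in>{1..n}. \<integral>\<^sup>+ u. indicator (?A k (add_mset (Upair x (S [x])) G) (\<lambda>us. S (x # us))) u \<partial>squares n) / of_nat n"
      using * by (simp only: indicator_def)
    also have "\<dots> = (\<Sum>x\<in>{1..n}. emeasure (squares n) (?A k (add_mset (Upair x (S [x])) G) (\<lambda>us. S (x # us)))) / of_nat n"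
      by (intro arg_cong2[where f="(/)"] sum.cong refl nn_integral_indicator sets_hitting_time_le)
    also have "\<dots> = ennreal ((\<Sum>x\<in>{1..n}. prob_within P n (add_mset (Upair x (S [x])) G) (\<lambda>us. S (x # us)) (real k)) / real n)"
      using assms by (simp only: emeasure_eq_measure prob_within_eq)
         (simp add: divide_ennreal[symmetric] sum_nonneg ennreal_of_nat_eq_real_of_nat)
    finally show ?thesis using False
      by (simp only: emeasure_eq_measure prob_within_eq if_False)
         (subst (asm) ennreal_inj; simp add: sum_nonneg)
  qed
qed

lemma prob_within_bounds: "0 \<le> prob_within P n G S x" "prob_within P n G S x \<le> 1"
  unfolding prob_within_def by (auto intro: prob_space.prob_le_1 prob_space_squares)

text \<open>The tail-sum formula makes the expected time a functional of the success probabilities.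
  Recursion and monotonicity for expected times are then read off from \<open>prob_within\<close>,
  without further integration.\<close>

lemma expected_time_eq_suminf:
  "expected_time P n G S = (\<Sum>k. ennreal (1 - prob_within P n G S (real k)))"
proof -
  interpret prob_space "squares n" by (rule prob_space_squares)
  have "hitting_time P n G S \<in> measurable (squares n) (count_space UNIV)"
  proof (subst measurable_count_space_eq2_countable, safe)
    fix h :: enat
    let ?L = "\<lambda>k. {u. \<exists>t\<le>k. P {1..n} (process G S u t)}"
    have eq: "hitting_time P n G S -` {h} \<inter> space (squares n) = (case h of \<infinity> \<Rightarrow> UNIV - (\<Union>k. ?L k) | enat k \<Rightarrow> ?L k - (\<Union>j<k. ?L j))"
    proof (cases h)
      case (enat k)
      have "hitting_time P n G S u = enat k \<longleftrightarrow> hitting_time P n G S u \<le> enat k \<and> (\<forall>j<k. \<not> hitting_time P n G S u \<le> enat j)" for u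
        by (cases "hitting_time P n G S u") (auto simp: not_le le_less)
      then show ?thesis using enat by (auto simp: hitting_time_le_iff)
    next
      case infinity
      have "hitting_time P n G S u = \<infinity> \<longleftrightarrow> (\<forall>j. \<not> hitting_time P n G S u \<le> enat j)" for u
        by (cases "hitting_time P n G S u") (auto simp: not_le)
      then show ?thesis using infinity by (auto simp: hitting_time_le_iff)
    qed
    have U: "UNIV \<in> sets (squares n)" using sets.top[of "squares n"] by simp
    show "hitting_time P n G S -` {h} \<inter> space (squares n) \<in> sets (squares n)"
      unfolding eq using sets_hitting_time_le[of _ P n G S] U
      by (cases h) (auto intro!: sets.Diff sets.countable_UN sets.finite_UN)
  qed auto
  then have "expected_time P n G S = (\<Sum>k. emeasure (squares n) {u \<in> space (squares n). enat k < hitting_time P n G S u})"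
    unfolding expected_time_def by (rule nn_integral_enat_function)
  also have "(\<lambda>k. emeasure (squares n) {u \<in> space (squares n). enat k < hitting_time P n G S u}) =
      (\<lambda>k. ennreal (1 - prob_within P n G S (real k)))"
  proof
    fix k
    have "{u \<in> space (squares n). enat k < hitting_time P n G S u} = space (squares n) - {u. \<exists>t\<le>k. P {1..n} (process G S u t)}"
      by (auto simp: not_le[symmetric] hitting_time_le_iff)
    then show "emeasure (squares n) {u \<in> space (squares n). enat k < hitting_time P n G S u} = ennreal (1 - prob_within P n G S (real k))"
      unfolding prob_within_eq emeasure_eq_measure by (simp only: prob_compl[OF sets_hitting_time_le])
  qed
  finally show ?thesis .
qed

section \<open>Optimal strategies\<close>

lemma strategies_tail:
  "S \<in> strategies n \<Longrightarrow> x \<in> {1..n} \<Longrightarrow> (\<lambda>us. S (x # us)) \<in> strategies n"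
  unfolding strategies_def by auto

lemma strategies_single: "S \<in> strategies n \<Longrightarrow> x \<in> {1..n} \<Longrightarrow> S [x] \<in> {1..n}"
  unfolding strategies_def by auto

lemma strategies_nonempty: "n \<ge> 1 \<Longrightarrow> (\<lambda>_. 1) \<in> strategies n"
  unfolding strategies_def by auto

lemma prob_within_cong:
  assumes "\<And>us. us \<noteq> [] \<Longrightarrow> S us = S' us"
  shows "prob_within P n G S x = prob_within P n G S' x"
proof -
  have "process G S u t = process G S' u t" for u t
    by (rule process_cong) (auto intro: assms)
  then show ?thesis unfolding prob_within_def hitting_time_def by simp
qed

definition first_then :: "(nat \<Rightarrow> nat) \<Rightarrow> (nat \<Rightarrow> strategy) \<Rightarrow> strategy" where
  "first_then g T us = (if length us = 1 then g (hd us) else T (hd us) (tl us))"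

lemma first_then_in_strategies:
  assumes "\<And>u. u \<in> {1..n} \<Longrightarrow> g u \<in> {1..n}" "\<And>u. u \<in> {1..n} \<Longrightarrow> T u \<in> strategies n"
  shows "first_then g T \<in> strategies n"
  unfolding strategies_def
proof safe
  fix us :: "nat list" assume "us \<noteq> []" "set us \<subseteq> {1..n}"
  then obtain u us' where us: "us = u # us'" "u \<in> {1..n}" "set us' \<subseteq> {1..n}"
    by (cases us) auto
  show "first_then g T us \<in> {1..n}"
    using assms us by (cases "us' = []") (auto simp: first_then_def strategies_def)
qed

lemma prob_within_first_then_tail:
  "prob_within P n G (\<lambda>us. first_then g T (u # us)) x = prob_within P n G (T u) x"
  by (rule prob_within_cong) (auto simp: first_then_def)

lemma prob_within_first_then:
  assumes "n \<ge> 1"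
  shows "prob_within P n G (first_then g T) (real (Suc k)) = (if P {1..n} G then 1 else
     (\<Sum>u\<in>{1..n}. prob_within P n (add_mset (Upair u (g u)) G) (T u) (real k)) / real n)"
  unfolding prob_within_Suc[OF assms] prob_within_first_then_tail
  by (simp add: first_then_def)

lemma expected_time_first_then_tail:
  "expected_time P n G (\<lambda>us. first_then g T (u # us)) = expected_time P n G (T u)"
  unfolding expected_time_eq_suminf prob_within_first_then_tail ..

text \<open>The value of the game with horizon \<open>k\<close>. The target is an arbitrary
  predicate on edge multisets because the block argument plays for two blocks at once, a goal that
  is not of the form \<open>P {1..n}\<close>.\<close>

fun win :: "(edges \<Rightarrow> bool) \<Rightarrow> nat \<Rightarrow> nat \<Rightarrow> edges \<Rightarrow> real" where
  "win A n 0 G = (if A G then 1 else 0)"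
| "win A n (Suc k) G = (if A G then 1 else
     (\<Sum>u\<in>{1..n}. Max ((\<lambda>v. win A n k (add_mset (Upair u v) G)) ` {1..n})) / real n)"

lemma prob_within_le_win:
  assumes "n \<ge> 1" "S \<in> strategies n"
  shows "prob_within P n G S (real k) \<le> win (P {1..n}) n k G"
  using assms(2)
proof (induction k arbitrary: G S)
  case (Suc k)
  have "(\<Sum>u\<in>{1..n}. prob_within P n (add_mset (Upair u (S [u])) G) (\<lambda>us. S (u # us)) (real k))
      \<le> (\<Sum>u\<in>{1..n}. Max ((\<lambda>v. win (P {1..n}) n k (add_mset (Upair u v) G)) ` {1..n}))"
  proof (rule sum_mono)
    fix u assume u: "u \<in> {1..n}"
    have "prob_within P n (add_mset (Upair u (S [u])) G) (\<lambda>us. S (u # us)) (real k)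
        \<le> win (P {1..n}) n k (add_mset (Upair u (S [u])) G)"
      using Suc.prems u by (intro Suc.IH strategies_tail)
    also have "\<dots> \<le> Max ((\<lambda>v. win (P {1..n}) n k (add_mset (Upair u v) G)) ` {1..n})"
      using strategies_single[OF Suc.prems u] by (intro Max_ge) auto
    finally show "prob_within P n (add_mset (Upair u (S [u])) G) (\<lambda>us. S (u # us)) (real k) \<le> \<dots>" .
  qed
  then show ?case unfolding prob_within_Suc[OF assms(1)] win.simps
    by (auto intro!: divide_right_mono)
qed (simp only: prob_within_0 win.simps order.refl)

text \<open>With a finite horizon and finitely many circles each maximum is attained, and
  \<open>first_then\<close> pastes the optimal continuations together.\<close>

lemma win_attained:
  assumes "n \<ge> 1"
  shows "\<exists>S\<in>strategies n. prob_within P n G S (real k) = win (P {1..n}) n k G"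
proof (induction k arbitrary: G)
  case 0
  show ?case using strategies_nonempty[OF assms] by (auto simp only: prob_within_0 win.simps)
next
  case (Suc k)
  have "\<forall>u. \<exists>v\<in>{1..n}. win (P {1..n}) n k (add_mset (Upair u v) G)
      = Max ((\<lambda>v. win (P {1..n}) n k (add_mset (Upair u v) G)) ` {1..n})"
  proof
    fix u
    have "Max ((\<lambda>v. win (P {1..n}) n k (add_mset (Upair u v) G)) ` {1..n})
      \<in> ((\<lambda>v. win (P {1..n}) n k (add_mset (Upair u v) G)) ` {1..n})"
      using assms by (intro Max_in) auto
    then show "\<exists>v\<in>{1..n}. win (P {1..n}) n k (add_mset (Upair u v) G)
      = Max ((\<lambda>v. win (P {1..n}) n k (add_mset (Upair u v) G)) ` {1..n})" by auto
  qed
  then obtain g where g: "\<And>u. g u \<in> {1..n}" "\<And>u. win (P {1..n}) n k (add_mset (Upair u (g u)) G)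
      = Max ((\<lambda>v. win (P {1..n}) n k (add_mset (Upair u v) G)) ` {1..n})" by metis
  obtain T where T: "\<And>G. T G \<in> strategies n" "\<And>G. prob_within P n G (T G) (real k) = win (P {1..n}) n k G"
    using Suc.IH by metis
  let ?S = "first_then g (\<lambda>u. T (add_mset (Upair u (g u)) G))"
  have "prob_within P n G ?S (real (Suc k)) = win (P {1..n}) n (Suc k) G"
    unfolding prob_within_first_then[OF assms] win.simps T(2) g(2) ..
  moreover have "?S \<in> strategies n" using g(1) T(1) by (intro first_then_in_strategies)
  ultimately show ?case by blast
qed

lemma win_bounds: "n \<ge> 1 \<Longrightarrow> 0 \<le> win A n k G \<and> win A n k G \<le> 1"
proof (induction k arbitrary: G)
  case (Suc k)
  have "0 \<le> Max ((\<lambda>v. win A n k (add_mset (Upair u v) G)) ` {1..n}) \<and>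
        Max ((\<lambda>v. win A n k (add_mset (Upair u v) G)) ` {1..n}) \<le> 1" for u
  proof
    have "0 \<le> win A n k (add_mset (Upair u 1) G)" using Suc by blast
    also have "\<dots> \<le> Max ((\<lambda>v. win A n k (add_mset (Upair u v) G)) ` {1..n})"
      using Suc.prems by (intro Max_ge) auto
    finally show "0 \<le> Max ((\<lambda>v. win A n k (add_mset (Upair u v) G)) ` {1..n})" .
    show "Max ((\<lambda>v. win A n k (add_mset (Upair u v) G)) ` {1..n}) \<le> 1"
      using Suc by (intro Max.boundedI) auto
  qed
  then have "0 \<le> (\<Sum>u\<in>{1..n}. Max ((\<lambda>v. win A n k (add_mset (Upair u v) G)) ` {1..n}))"
    "(\<Sum>u\<in>{1..n}. Max ((\<lambda>v. win A n k (add_mset (Upair u v) G)) ` {1..n})) \<le> real (card {1..n}) * 1"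
    using sum_bounded_above[of "{1..n}" "\<lambda>u. Max ((\<lambda>v. win A n k (add_mset (Upair u v) G)) ` {1..n})" 1]
    by (auto intro!: sum_nonneg)
  then show ?case using Suc.prems by (auto simp: divide_le_eq)
qed auto

lemma prob_within_mono:
  "x \<le> y \<Longrightarrow> prob_within P n G S x \<le> prob_within P n G S y"
proof (cases "x < 0")
  case True
  then show ?thesis by (simp add: prob_within_neg prob_within_bounds)
next
  case False
  assume "x \<le> y"
  interpret prob_space "squares n" by (rule prob_space_squares)
  have "nat \<lfloor>x\<rfloor> \<le> nat \<lfloor>y\<rfloor>" using \<open>x \<le> y\<close> by (intro nat_mono floor_mono)
  then have "{u. \<exists>t\<le>nat \<lfloor>x\<rfloor>. P {1..n} (process G S u t)} \<subseteq> {u. \<exists>t\<le>nat \<lfloor>y\<rfloor>. P {1..n} (process G S u t)}"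
    using le_trans by blast
  then have "prob_within P n G S (real (nat \<lfloor>x\<rfloor>)) \<le> prob_within P n G S (real (nat \<lfloor>y\<rfloor>))"
    unfolding prob_within_eq
    by (rule finite_measure_mono[OF _ sets_hitting_time_le[of "nat \<lfloor>y\<rfloor>" P n G S]])
  then show ?thesis using prob_within_floor[of x P n G S] prob_within_floor[of y P n G S] False \<open>x \<le> y\<close> by linarith
qed

lemma expected_time_rec:
  assumes "n \<ge> 1"
  shows "expected_time P n G S = (if P {1..n} G then 0 else
     1 + (\<Sum>u\<in>{1..n}. expected_time P n (add_mset (Upair u (S [u])) G) (\<lambda>us. S (u # us))) / of_nat n)"
proof (cases "P {1..n} G")
  case True
  have "prob_within P n G S (real k) = 1" for k
    using True by (cases k) (simp_all only: prob_within_0 prob_within_Suc[OF assms] if_True)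
  then show ?thesis using True unfolding expected_time_eq_suminf by simp
next
  case False
  let ?p = "\<lambda>u k. prob_within P n (add_mset (Upair u (S [u])) G) (\<lambda>us. S (u # us)) (real k)"
  have "expected_time P n G S = (\<Sum>k. ennreal (1 - prob_within P n G S (real (Suc k)))) + ennreal (1 - prob_within P n G S (real 0))"
    unfolding expected_time_eq_suminf by (subst suminf_offset[where i=1]) auto
  also have "(\<lambda>k. ennreal (1 - prob_within P n G S (real (Suc k)))) = (\<lambda>k. (\<Sum>u\<in>{1..n}. ennreal (1 - ?p u k)) / of_nat n)"
  proof
    fix k
    have "1 - prob_within P n G S (real (Suc k)) = (\<Sum>u\<in>{1..n}. 1 - ?p u k) / real n"
      using False assms unfolding prob_within_Suc[OF assms] by (simp add: sum_subtractf field_simps)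
    then show "ennreal (1 - prob_within P n G S (real (Suc k))) = (\<Sum>u\<in>{1..n}. ennreal (1 - ?p u k)) / of_nat n"
      using assms prob_within_bounds
      by (simp add: divide_ennreal[symmetric] sum_nonneg ennreal_of_nat_eq_real_of_nat sum_ennreal)
  qed
  also have "(\<Sum>k. (\<Sum>u\<in>{1..n}. ennreal (1 - ?p u k)) / of_nat n) = (\<Sum>u\<in>{1..n}. \<Sum>k. ennreal (1 - ?p u k)) / of_nat n"
    unfolding divide_ennreal_def by (simp add: suminf_sum)
  finally show ?thesis using False unfolding expected_time_eq_suminf prob_within_0
    by (simp add: add.commute)
qed

section \<open>The optimal expected time and its Bellman equation\<close>

definition opt_time :: "property \<Rightarrow> nat \<Rightarrow> edges \<Rightarrow> ennreal" where
  "opt_time P n G = (INF S\<in>strategies n. expected_time P n G S)"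

lemma optimal_time_eq: "optimal_time P n = opt_time P n {#}"
  by (simp add: optimal_time_def opt_time_def)

text \<open>The infimum over strategies need not be attained, so the upper bound pastes together
  continuations that are within \<open>e\<close> of optimal, one for each first square. For the
  lower bound any strategy is split after its first square.\<close>

lemma opt_time_bellman:
  assumes "n \<ge> 1"
  shows "opt_time P n G = (if P {1..n} G then 0 else
    1 + (\<Sum>u\<in>{1..n}. INF v\<in>{1..n}. opt_time P n (add_mset (Upair u v) G)) / of_nat n)"
proof (cases "P {1..n} G")
  case True
  then show ?thesis unfolding opt_time_def expected_time_rec[OF assms, of P G]
    using strategies_nonempty[OF assms] by (auto intro!: INF_eq_const)
next
  case False
  let ?I = "\<lambda>u. INF v\<in>{1..n}. opt_time P n (add_mset (Upair u v) G)"
  have "opt_time P n G \<le> 1 + (\<Sum>u\<in>{1..n}. ?I u) / of_nat n"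
  proof (rule ennreal_le_epsilon)
    fix e :: real assume fin: "1 + (\<Sum>u\<in>{1..n}. ?I u) / of_nat n < top" and "e > 0"
    have "?I u < top" if "u \<in> {1..n}" for u
    proof -
      have "(\<Sum>u\<in>{1..n}. ?I u) < top"
        using fin assms by (auto simp: divide_ennreal_def ennreal_mult_less_top top_unique less_top[symmetric] ennreal_mult_eq_top_iff)
      moreover have "?I u \<le> (\<Sum>u\<in>{1..n}. ?I u)" using that by (intro member_le_sum) auto
      ultimately show ?thesis by (rule order.strict_trans1[rotated])
    qed
    then have lt: "?I u < ?I u + ennreal e" if "u \<in> {1..n}" for u
    proof -
      have "x < x + ennreal e" if "x < top" for x :: ennreal
        using that \<open>e > 0\<close>
        by (cases x rule: ennreal_cases) (simp_all add: ennreal_plus[symmetric] ennreal_lessI del: ennreal_plus)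
      then show ?thesis using \<open>\<And>u. u \<in> {1..n} \<Longrightarrow> ?I u < top\<close> that by blast
    qed
    have "\<exists>v\<in>{1..n}. \<exists>S\<in>strategies n. expected_time P n (add_mset (Upair u v) G) S < ?I u + ennreal e" if "u \<in> {1..n}" for u
    proof -
      have "\<exists>v\<in>{1..n}. opt_time P n (add_mset (Upair u v) G) < ?I u + ennreal e"
        using lt[OF that] by (subst (asm) INF_less_iff)
      then show ?thesis unfolding opt_time_def INF_less_iff by blast
    qed
    then obtain g T where g: "\<And>u. u \<in> {1..n} \<Longrightarrow> g u \<in> {1..n}" and T: "\<And>u. u \<in> {1..n} \<Longrightarrow> T u \<in> strategies n"
      and le: "\<And>u. u \<in> {1..n} \<Longrightarrow> expected_time P n (add_mset (Upair u (g u)) G) (T u) < ?I u + ennreal e"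
      by metis
    have "opt_time P n G \<le> expected_time P n G (first_then g T)"
      unfolding opt_time_def by (intro INF_lower first_then_in_strategies g T)
    also have "\<dots> = 1 + (\<Sum>u\<in>{1..n}. expected_time P n (add_mset (Upair u (g u)) G) (T u)) / of_nat n"
      using False unfolding expected_time_rec[OF assms, of P G "first_then g T"] expected_time_first_then_tail
      by (simp add: first_then_def)
    also have "\<dots> \<le> 1 + (\<Sum>u\<in>{1..n}. ?I u + ennreal e) / of_nat n"
      by (intro add_left_mono divide_right_mono_ennreal sum_mono less_imp_le le)
    also have "\<dots> = 1 + (\<Sum>u\<in>{1..n}. ?I u) / of_nat n + ennreal e"
    proof -
      have "of_nat n * ennreal e / of_nat n = ennreal e"
        using assms by (simp add: mult.commute ennreal_mult_divide_eq)
      then show ?thesis by (simp add: sum.distrib add_divide_distrib_ennreal add.assoc)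
    qed
    finally show "opt_time P n G \<le> 1 + (\<Sum>u\<in>{1..n}. ?I u) / of_nat n + ennreal e" .
  qed
  moreover have "1 + (\<Sum>u\<in>{1..n}. ?I u) / of_nat n \<le> opt_time P n G"
    unfolding opt_time_def[of P n G]
  proof (rule INF_greatest)
    fix S assume S: "S \<in> strategies n"
    have "?I u \<le> expected_time P n (add_mset (Upair u (S [u])) G) (\<lambda>us. S (u # us))" if u: "u \<in> {1..n}" for u
    proof -
      have "?I u \<le> opt_time P n (add_mset (Upair u (S [u])) G)"
        using strategies_single[OF S u] by (rule INF_lower)
      also have "\<dots> \<le> expected_time P n (add_mset (Upair u (S [u])) G) (\<lambda>us. S (u # us))"
        unfolding opt_time_def[of P n "add_mset (Upair u (S [u])) G"] by (intro INF_lower strategies_tail S u)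
      finally show ?thesis .
    qed
    then have "1 + (\<Sum>u\<in>{1..n}. ?I u) / of_nat n \<le>
       1 + (\<Sum>u\<in>{1..n}. expected_time P n (add_mset (Upair u (S [u])) G) (\<lambda>us. S (u # us))) / of_nat n"
      by (intro add_left_mono divide_right_mono_ennreal sum_mono)
    then show "1 + (\<Sum>u\<in>{1..n}. ?I u) / of_nat n \<le> expected_time P n G S"
      using False by (simp add: expected_time_rec[OF assms, of P G S])
  qed
  ultimately have "opt_time P n G = 1 + (\<Sum>u\<in>{1..n}. ?I u) / of_nat n" by (rule antisym)
  then show ?thesis using False by (simp only: if_False)
qed

text \<open>The play that follows a rule depending on the current graph. A strategy is given squares
  only, so the graph is rebuilt along the list.\<close>

primrec greedy :: "(edges \<Rightarrow> nat \<Rightarrow> nat) \<Rightarrow> edges \<Rightarrow> strategy" where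
  "greedy g G [] = 1"
| "greedy g G (u # us) = (if us = [] then g G u else greedy g (add_mset (Upair u (g G u)) G) us)"

lemma greedy_in_strategies:
  assumes "\<And>G u. u \<in> {1..n} \<Longrightarrow> g G u \<in> {1..n}"
  shows "greedy g G \<in> strategies n"
proof -
  have "us \<noteq> [] \<longrightarrow> set us \<subseteq> {1..n} \<longrightarrow> greedy g G us \<in> {1..n}" for us
    by (induction us arbitrary: G) (use assms in auto)
  then show ?thesis unfolding strategies_def by blast
qed

lemma mgraph_add:
  "mgraph {1..n} G \<Longrightarrow> u \<in> {1..n} \<Longrightarrow> v \<in> {1..n} \<Longrightarrow> mgraph {1..n} (add_mset (Upair u v) G)"
  unfolding mgraph_def by auto

text \<open>Verification principle: always moving to the least value of \<open>W\<close> takes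
  expected time at most \<open>W G\<close>. The partial sums of the tail-sum formula are bounded by
  induction on their length, so \<open>W\<close> may take infinite values.\<close>

lemma opt_time_le_superharmonic:
  assumes "n \<ge> 1" and W: "\<And>G. mgraph {1..n} G \<Longrightarrow> \<not> P {1..n} G \<Longrightarrow>
      1 + (\<Sum>u\<in>{1..n}. INF v\<in>{1..n}. W (add_mset (Upair u v) G)) / of_nat n \<le> W G"
    and "mgraph {1..n} G"
  shows "opt_time P n G \<le> W G"
proof -
  have "\<exists>v\<in>{1..n}. W (add_mset (Upair u v) G) = (INF v\<in>{1..n}. W (add_mset (Upair u v) G))" for G u
  proof -
    have "Min ((\<lambda>v. W (add_mset (Upair u v) G)) ` {1..n}) \<in> (\<lambda>v. W (add_mset (Upair u v) G)) ` {1..n}"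
      using \<open>n \<ge> 1\<close> by (intro Min_in) auto
    then show ?thesis using \<open>n \<ge> 1\<close> by (subst (asm) Min_Inf) auto
  qed
  then have "\<exists>v. v \<in> {1..n} \<and> W (add_mset (Upair u v) G) = (INF v\<in>{1..n}. W (add_mset (Upair u v) G))" for G u
    by blast
  note someI_ex[OF this]
  then obtain g where g: "\<And>G u. g G u \<in> {1..n}"
    "\<And>G u. W (add_mset (Upair u (g G u)) G) = (INF v\<in>{1..n}. W (add_mset (Upair u v) G))"
    by fast
  have tail: "prob_within P n H (\<lambda>us. greedy g G (u # us)) x = prob_within P n H (greedy g (add_mset (Upair u (g G u)) G)) x" for G H u x
    by (rule prob_within_cong) auto
  have "(\<Sum>k<K. ennreal (1 - prob_within P n G (greedy g G) (real k))) \<le> W G" if "mgraph {1..n} G" for K G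
    using that
  proof (induction K arbitrary: G)
    case (Suc K)
    show ?case
    proof (cases "P {1..n} G")
      case True
      have "prob_within P n G S (real k) = 1" for k S
        using True by (cases k) (simp_all only: prob_within_0 prob_within_Suc[OF assms(1)] if_True)
      then show ?thesis by simp
    next
      case False
      let ?G = "\<lambda>u. add_mset (Upair u (g G u)) G"
      let ?p = "\<lambda>u k. prob_within P n (?G u) (greedy g (?G u)) (real k)"
      have *: "1 - prob_within P n G (greedy g G) (real (Suc k)) = (\<Sum>u\<in>{1..n}. 1 - ?p u k) / real n" for k
        using False assms unfolding prob_within_Suc[OF assms(1)] tail by (simp add: sum_subtractf field_simps)
      have "(\<Sum>k<Suc K. ennreal (1 - prob_within P n G (greedy g G) (real k)))
         = 1 + (\<Sum>k<K. ennreal (1 - prob_within P n G (greedy g G) (real (Suc k))))"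
        using False by (subst sum.lessThan_Suc_shift) (simp only: prob_within_0, simp)
      also have "\<dots> = 1 + (\<Sum>k<K. (\<Sum>u\<in>{1..n}. ennreal (1 - ?p u k)) / of_nat n)"
        unfolding * using assms(1) prob_within_bounds
        by (simp add: divide_ennreal[symmetric] sum_nonneg ennreal_of_nat_eq_real_of_nat sum_ennreal)
      also have "\<dots> = 1 + (\<Sum>u\<in>{1..n}. \<Sum>k<K. ennreal (1 - ?p u k)) / of_nat n"
      proof -
        have "(\<Sum>k<K. (\<Sum>u\<in>{1..n}. ennreal (1 - ?p u k)) / of_nat n) =
            (\<Sum>k<K. \<Sum>u\<in>{1..n}. ennreal (1 - ?p u k)) / of_nat n"
          unfolding divide_ennreal_def by (rule sum_distrib_right[symmetric])
        moreover have "(\<Sum>k<K. \<Sum>u\<in>{1..n}. ennreal (1 - ?p u k)) = (\<Sum>u\<in>{1..n}. \<Sum>k<K. ennreal (1 - ?p u k))"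
          by (rule sum.swap)
        ultimately show ?thesis by (simp only:)
      qed
      also have "\<dots> \<le> 1 + (\<Sum>u\<in>{1..n}. W (?G u)) / of_nat n"
        using Suc.prems g(1) by (intro add_left_mono divide_right_mono_ennreal sum_mono Suc.IH mgraph_add)
      also have "\<dots> \<le> W G" using W[OF Suc.prems False] by (simp add: g(2))
      finally show ?thesis .
    qed
  qed simp
  then have "expected_time P n G (greedy g G) \<le> W G"
    unfolding expected_time_eq_suminf using assms(3)
    by (intro suminf_le_const) auto
  moreover have "opt_time P n G \<le> expected_time P n G (greedy g G)"
    unfolding opt_time_def by (intro INF_lower greedy_in_strategies g)
  ultimately show ?thesis by (rule order_trans[rotated])
qed

text \<open>Coupling: since strategies do not look at the graph, both games can be run with the same
  squares and the same circles, and the inclusion persists.\<close>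

lemma prob_within_mono_graph:
  assumes "n \<ge> 1" "monotone_increasing P" "S \<in> strategies n" "G \<subseteq># G'" "mgraph {1..n} G'"
  shows "prob_within P n G S (real k) \<le> prob_within P n G' S (real k)"
  using assms(3-5)
proof (induction k arbitrary: G G' S)
  case 0
  then show ?case using assms(2) by (simp only: prob_within_0) (auto simp: monotone_increasing_def)
next
  case (Suc k)
  show ?case
  proof (cases "P {1..n} G'")
    case True
    then show ?thesis using prob_within_bounds(2)[of P n G S "real (Suc k)"]
      unfolding prob_within_Suc[OF assms(1), of P G'] by (simp only: if_True)
  next
    case False
    then have "\<not> P {1..n} G" using assms(2) Suc.prems unfolding monotone_increasing_def by blast
    moreover have "(\<Sum>x\<in>{1..n}. prob_within P n (add_mset (Upair x (S [x])) G) (\<lambda>us. S (x # us)) (real k)) / real n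
      \<le> (\<Sum>x\<in>{1..n}. prob_within P n (add_mset (Upair x (S [x])) G') (\<lambda>us. S (x # us)) (real k)) / real n"
      using Suc.prems strategies_single[OF Suc.prems(1)]
      by (intro divide_right_mono sum_mono Suc.IH strategies_tail mgraph_add) auto
    ultimately show ?thesis using False unfolding prob_within_Suc[OF assms(1)] by simp
  qed
qed

lemma opt_time_antimono:
  assumes "n \<ge> 1" "monotone_increasing P" "G \<subseteq># G'" "mgraph {1..n} G'"
  shows "opt_time P n G' \<le> opt_time P n G"
  unfolding opt_time_def expected_time_eq_suminf
  using prob_within_mono_graph[OF assms(1,2) _ assms(3,4)]
  by (intro INF_mono bexI suminf_le ennreal_leI) auto

section \<open>Concentration of the hitting time\<close>

lemma Max_image_attained:
  assumes "n \<ge> (1::nat)"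
  obtains v where "v \<in> {1..n}" "f v = Max (f ` {1..n})"
proof -
  have "Max (f ` {1..n}) \<in> f ` {1..n}" using assms by (intro Max_in) auto
  then show ?thesis using that by auto
qed

lemma Min_image_attained:
  assumes "n \<ge> (1::nat)"
  obtains v where "v \<in> {1..n}" "f v = Min (f ` {1..n})"
proof -
  have "Min (f ` {1..n}) \<in> f ` {1..n}" using assms by (intro Min_in) auto
  then show ?thesis using that by auto
qed

text \<open>Markov's inequality for a nonnegative supermartingale, by induction on the steps left:
  \<open>\<phi>\<close> is at least 1 if time runs out without success, and some rule
  \<open>g\<close> keeps its average from growing. The rule may depend on the graph and on the steps
  left.\<close>

lemma one_minus_win_le_potential:
  fixes \<phi> :: "nat \<Rightarrow> edges \<Rightarrow> real"
  assumes "n \<ge> 1" and nn: "\<And>k G. 0 \<le> \<phi> k G"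
    and base: "\<And>G. mgraph {1..n} G \<Longrightarrow> \<not> A G \<Longrightarrow> 1 \<le> \<phi> 0 G"
    and step: "\<And>k G. mgraph {1..n} G \<Longrightarrow> \<not> A G \<Longrightarrow>
      \<exists>g. (\<forall>u\<in>{1..n}. g u \<in> {1..n}) \<and> (\<Sum>u\<in>{1..n}. \<phi> k (add_mset (Upair u (g u)) G)) / real n \<le> \<phi> (Suc k) G"
    and "mgraph {1..n} G"
  shows "1 - win A n k G \<le> \<phi> k G"
  using \<open>mgraph {1..n} G\<close>
proof (induction k arbitrary: G)
  case 0
  then show ?case using base[of G] nn by auto
next
  case (Suc k)
  show ?case
  proof (cases "A G")
    case True
    then show ?thesis using nn by simp
  next
    case False
    obtain g where g: "\<And>u. u \<in> {1..n} \<Longrightarrow> g u \<in> {1..n}"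
      "(\<Sum>u\<in>{1..n}. \<phi> k (add_mset (Upair u (g u)) G)) / real n \<le> \<phi> (Suc k) G"
      using step[OF Suc.prems False] by blast
    have "1 - win A n (Suc k) G = (\<Sum>u\<in>{1..n}. 1 - Max ((\<lambda>v. win A n k (add_mset (Upair u v) G)) ` {1..n})) / real n"
      using False assms(1) by (simp add: sum_subtractf field_simps)
    also have "\<dots> \<le> (\<Sum>u\<in>{1..n}. \<phi> k (add_mset (Upair u (g u)) G)) / real n"
    proof (intro divide_right_mono sum_mono)
      fix u assume u: "u \<in> {1..n}"
      have "win A n k (add_mset (Upair u (g u)) G) \<le> Max ((\<lambda>v. win A n k (add_mset (Upair u v) G)) ` {1..n})"
        using g(1)[OF u] by (intro Max_ge) auto
      moreover have "1 - win A n k (add_mset (Upair u (g u)) G) \<le> \<phi> k (add_mset (Upair u (g u)) G)"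
        by (intro Suc.IH mgraph_add Suc.prems u g)
      ultimately show "1 - Max ((\<lambda>v. win A n k (add_mset (Upair u v) G)) ` {1..n}) \<le> \<phi> k (add_mset (Upair u (g u)) G)"
        by linarith
    qed simp
    finally show ?thesis using g(2) by linarith
  qed
qed

lemma Hoeffding_average:
  fixes x :: "nat \<Rightarrow> real"
  assumes "n \<ge> 1" and x: "\<And>u. u \<in> {1..n} \<Longrightarrow> x u \<in> {a..b}" and "l > 0"
  shows "(\<Sum>u\<in>{1..n}. exp (l * (x u - (\<Sum>u\<in>{1..n}. x u) / real n))) / real n \<le> exp (l\<^sup>2 * (b - a)\<^sup>2 / 8)"
proof -
  let ?p = "pmf_of_set {1..n}"
  have fin: "finite {1..n}" "{1..n} \<noteq> {}" using assms(1) by auto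
  interpret interval_bounded_random_variable "measure_pmf ?p" x a b
    by unfold_locales (use x fin in \<open>auto simp: AE_measure_pmf_iff\<close>)
  have E: "measure_pmf.expectation ?p x = (\<Sum>u\<in>{1..n}. x u) / real n"
    by (subst integral_pmf_of_set) (use fin in auto)
  have "nn_integral ?p (\<lambda>u. exp (l * (x u - measure_pmf.expectation ?p x))) \<le> ennreal (exp (l\<^sup>2 * (b - a)\<^sup>2 / 8))"
    by (rule Hoeffdings_lemma_nn_integral[OF \<open>l > 0\<close>])
  also have "nn_integral ?p (\<lambda>u. exp (l * (x u - measure_pmf.expectation ?p x))) = ennreal ((\<Sum>u\<in>{1..n}. exp (l * (x u - measure_pmf.expectation ?p x))) / real n)"
    using fin assms(1) by (subst nn_integral_pmf_of_set)
      (auto simp: divide_ennreal[symmetric] sum_nonneg ennreal_of_nat_eq_real_of_nat sum_ennreal)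
  finally show ?thesis unfolding E by simp
qed

definition rtime :: "property \<Rightarrow> nat \<Rightarrow> edges \<Rightarrow> real" where
  "rtime P n G = enn2real (opt_time P n G)"

text \<open>Finiteness from the empty graph passes to all graphs by monotonicity, so on graphs
  \<open>rtime\<close> never takes the default value 0 that \<open>enn2real\<close> assigns to
  infinity.\<close>

locale semi_random =
  fixes P :: property and n :: nat
  assumes n: "n \<ge> 1" and mono: "monotone_increasing P" and fin: "opt_time P n {#} < top"
begin

lemma mono_add: "mgraph {1..n} (add_mset e G) \<Longrightarrow> P {1..n} G \<Longrightarrow> P {1..n} (add_mset e G)"
proof -
  assume "mgraph {1..n} (add_mset e G)" "P {1..n} G"
  moreover have "G \<subseteq># add_mset e G" by simp
  ultimately show ?thesis using mono unfolding monotone_increasing_def by blast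
qed

lemma opt_time_finite: "mgraph {1..n} G \<Longrightarrow> opt_time P n G < top"
  using opt_time_antimono[OF n mono, of "{#}" G] fin by (auto intro: order.strict_trans1)

lemma ennreal_rtime: "mgraph {1..n} G \<Longrightarrow> ennreal (rtime P n G) = opt_time P n G"
  unfolding rtime_def using opt_time_finite[of G] by simp

lemma rtime_nonneg: "0 \<le> rtime P n G"
  unfolding rtime_def by simp

lemma rtime_antimono: "G \<subseteq># G' \<Longrightarrow> mgraph {1..n} G' \<Longrightarrow> rtime P n G' \<le> rtime P n G"
proof -
  assume *: "G \<subseteq># G'" "mgraph {1..n} G'"
  then have "mgraph {1..n} G" unfolding mgraph_def by (auto dest: mset_subset_eqD)
  then show ?thesis unfolding rtime_def
    using opt_time_antimono[OF n mono *] opt_time_finite by (intro enn2real_mono)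
qed

lemma rtime_bellman:
  assumes G: "mgraph {1..n} G" and "\<not> P {1..n} G"
  shows "rtime P n G = 1 + (\<Sum>u\<in>{1..n}. Min ((\<lambda>v. rtime P n (add_mset (Upair u v) G)) ` {1..n})) / real n"
proof -
  have INF: "(INF v\<in>{1..n}. opt_time P n (add_mset (Upair u v) G)) = ennreal (Min ((\<lambda>v. rtime P n (add_mset (Upair u v) G)) ` {1..n}))"
    if u: "u \<in> {1..n}" for u
  proof -
    obtain v where v: "v \<in> {1..n}" "rtime P n (add_mset (Upair u v) G) = Min ((\<lambda>v. rtime P n (add_mset (Upair u v) G)) ` {1..n})"
      using Min_image_attained[OF n, of "\<lambda>v. rtime P n (add_mset (Upair u v) G)"] by blast
    have "(INF v\<in>{1..n}. opt_time P n (add_mset (Upair u v) G)) = opt_time P n (add_mset (Upair u v) G)"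
    proof (rule antisym)
      show "opt_time P n (add_mset (Upair u v) G) \<le> (INF v\<in>{1..n}. opt_time P n (add_mset (Upair u v) G))"
      proof (rule INF_greatest)
        fix w assume w: "w \<in> {1..n}"
        have "rtime P n (add_mset (Upair u v) G) \<le> rtime P n (add_mset (Upair u w) G)"
          unfolding v(2) using w by (intro Min_le) auto
        then show "opt_time P n (add_mset (Upair u v) G) \<le> opt_time P n (add_mset (Upair u w) G)"
          using mgraph_add[OF G u] v(1) w by (simp add: ennreal_leI flip: ennreal_rtime)
      qed
    qed (rule INF_lower[OF v(1)])
    also have "\<dots> = ennreal (rtime P n (add_mset (Upair u v) G))"
      by (rule ennreal_rtime[symmetric]) (intro mgraph_add G u v)
    finally show ?thesis by (simp only: v(2))
  qed
  have nn: "0 \<le> Min ((\<lambda>v. rtime P n (add_mset (Upair u v) G)) ` {1..n})" for u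
    using n by (intro Min.boundedI) (auto simp: rtime_nonneg)
  have "opt_time P n G = 1 + (\<Sum>u\<in>{1..n}. ennreal (Min ((\<lambda>v. rtime P n (add_mset (Upair u v) G)) ` {1..n}))) / of_nat n"
    using assms(2) INF by (subst opt_time_bellman[OF n]) simp
  also have "\<dots> = ennreal (1 + (\<Sum>u\<in>{1..n}. Min ((\<lambda>v. rtime P n (add_mset (Upair u v) G)) ` {1..n})) / real n)"
    using n nn by (simp add: divide_ennreal[symmetric] sum_nonneg ennreal_of_nat_eq_real_of_nat sum_ennreal)
  finally have "rtime P n G = enn2real \<dots>" unfolding rtime_def[of P n G] by (rule arg_cong)
  then show ?thesis using nn by (subst (asm) enn2real_ennreal) (auto simp: sum_nonneg)
qed

lemma rtime_eq_0: "P {1..n} G \<Longrightarrow> rtime P n G = 0"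
  unfolding rtime_def by (subst opt_time_bellman[OF n]) simp

text \<open>Play \<open>k\<close> steps for the target \<open>A\<close>; success leaves at most
  \<open>D\<close>, and failure, of probability \<open>1 - win A n k G\<close>, leaves at most
  \<open>B\<close>. The bounds are required only above \<open>G\<close>, which allows
  \<open>B\<close> to be the remaining time of \<open>G\<close> itself.\<close>

lemma rtime_le_win:
  assumes "\<And>H. G \<subseteq># H \<Longrightarrow> mgraph {1..n} H \<Longrightarrow> A H \<Longrightarrow> rtime P n H \<le> D"
    and "\<And>H. G \<subseteq># H \<Longrightarrow> mgraph {1..n} H \<Longrightarrow> rtime P n H \<le> B"
    and "mgraph {1..n} G" "0 \<le> D" "0 \<le> B"
  shows "rtime P n G \<le> real k + D + (1 - win A n k G) * B"
  using assms(1-3)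
proof (induction k arbitrary: G)
  case 0
  then show ?case using \<open>0 \<le> D\<close> \<open>0 \<le> B\<close> by (cases "A G") (force+)
next
  case (Suc k)
  show ?case
  proof (cases "A G \<or> P {1..n} G")
    case True
    then have "rtime P n G \<le> D" using Suc.prems(1)[of G] Suc.prems(3) rtime_eq_0[of G] \<open>0 \<le> D\<close> by auto
    moreover have "0 \<le> (1 - win A n (Suc k) G) * B"
      using win_bounds[OF n, of A "Suc k" G] \<open>0 \<le> B\<close> by simp
    ultimately show ?thesis by simp
  next
    case False
    let ?w = "\<lambda>u. Max ((\<lambda>v. win A n k (add_mset (Upair u v) G)) ` {1..n})"
    have "Min ((\<lambda>v. rtime P n (add_mset (Upair u v) G)) ` {1..n}) \<le> real k + D + (1 - ?w u) * B" if u: "u \<in> {1..n}" for u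
    proof -
      obtain v where v: "v \<in> {1..n}" "win A n k (add_mset (Upair u v) G) = ?w u"
        using Max_image_attained[OF n, of "\<lambda>v. win A n k (add_mset (Upair u v) G)"] by blast
      have "Min ((\<lambda>v. rtime P n (add_mset (Upair u v) G)) ` {1..n}) \<le> rtime P n (add_mset (Upair u v) G)"
        using v(1) by (intro Min_le) auto
      also have "\<dots> \<le> real k + D + (1 - win A n k (add_mset (Upair u v) G)) * B"
      proof (rule Suc.IH)
        fix H assume "add_mset (Upair u v) G \<subseteq># H" and H: "mgraph {1..n} H"
        then have "G \<subseteq># H" by (intro subset_mset.order_trans[of G "add_mset (Upair u v) G" H]) simp_all
        then show "rtime P n H \<le> B" and "A H \<Longrightarrow> rtime P n H \<le> D" using Suc.prems(1,2) H by auto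
      qed (intro mgraph_add Suc.prems u v)
      finally show ?thesis unfolding v(2) .
    qed
    then have "rtime P n G \<le> 1 + (\<Sum>u\<in>{1..n}. real k + D + (1 - ?w u) * B) / real n"
      using False by (subst rtime_bellman[OF Suc.prems(3)]) (auto intro!: divide_right_mono sum_mono)
    also have "(\<Sum>u\<in>{1..n}. real k + D + (1 - ?w u) * B) = real n * (real k + D + B) - (\<Sum>u\<in>{1..n}. ?w u) * B"
      by (simp add: algebra_simps sum.distrib sum_subtractf sum_distrib_left)
    also have "1 + \<dots> / real n = real (Suc k) + D + (1 - win A n (Suc k) G) * B"
      using False n by (simp add: field_simps)
    finally show ?thesis .
  qed
qed

text \<open>Restarting: a failed attempt leaves a supergraph of \<open>G\<close>, which is no worse
  than \<open>G\<close>. With T the remaining time this gives T \<le> k + T/2, and T is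
  finite.\<close>

lemma rtime_le_of_win_half:
  assumes G: "mgraph {1..n} G" and "win (P {1..n}) n k G \<ge> 1/2"
  shows "rtime P n G \<le> 2 * real k"
proof -
  have "rtime P n G \<le> real k + 0 + (1 - win (P {1..n}) n k G) * rtime P n G"
    using G by (intro rtime_le_win) (auto simp: rtime_eq_0 rtime_nonneg intro: rtime_antimono)
  moreover have "(1 - win (P {1..n}) n k G) * rtime P n G \<le> 1/2 * rtime P n G"
    using assms(2) by (intro mult_right_mono rtime_nonneg) simp
  ultimately show ?thesis by simp
qed

lemma one_minus_win_markov: "real k * (1 - win (P {1..n}) n k {#}) \<le> rtime P n {#}"
proof -
  have "ennreal (real k * (1 - win (P {1..n}) n k {#})) \<le> expected_time P n {#} S" if S: "S \<in> strategies n" for S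
  proof -
    let ?p = "\<lambda>j. prob_within P n {#} S (real j)"
    have "real k * (1 - win (P {1..n}) n k {#}) \<le> (\<Sum>j<k. 1 - ?p j)"
    proof -
      have "1 - win (P {1..n}) n k {#} \<le> 1 - ?p j" if "j < k" for j
        using prob_within_le_win[OF n S, of P "{#}" k] prob_within_mono[of "real j" "real k" P n "{#}" S] that by simp
      then have "(\<Sum>j<k. 1 - win (P {1..n}) n k {#}) \<le> (\<Sum>j<k. 1 - ?p j)" by (intro sum_mono) auto
      then show ?thesis by simp
    qed
    then have "ennreal (real k * (1 - win (P {1..n}) n k {#})) \<le> (\<Sum>j<k. ennreal (1 - ?p j))"
      using prob_within_bounds by (simp add: sum_ennreal ennreal_leI)
    also have "\<dots> \<le> expected_time P n {#} S"
      unfolding expected_time_eq_suminf by (rule sum_le_suminf) auto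
    finally show ?thesis .
  qed
  then have "ennreal (real k * (1 - win (P {1..n}) n k {#})) \<le> opt_time P n {#}"
    unfolding opt_time_def by (rule INF_greatest)
  then show ?thesis using ennreal_rtime[of "{#}"] rtime_nonneg[of "{#}"]
    by (simp add: mgraph_def flip: ennreal_le_iff)
qed

section \<open>The effect of deleting one edge, and the lower tail of the hitting time\<close>

definition lipschitz_const :: "real \<Rightarrow> bool" where
  "lipschitz_const c \<longleftrightarrow> 0 \<le> c \<and> (\<forall>G e. mgraph {1..n} (add_mset e G) \<longrightarrow> rtime P n G \<le> rtime P n (add_mset e G) + c)"

lemma lipschitz_constI:
  assumes "0 \<le> c" and rep: "\<And>G e. mgraph {1..n} (add_mset e G) \<Longrightarrow> P {1..n} (add_mset e G) \<Longrightarrow> rtime P n G \<le> c"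
  shows "lipschitz_const c"
  unfolding lipschitz_const_def
proof (intro conjI allI impI)
  fix G e assume Ge: "mgraph {1..n} (add_mset e G)"
  then have G: "mgraph {1..n} G" and e: "set_uprod e \<subseteq> {1..n}" by (auto simp: mgraph_def)
  have E: "mgraph {1..n} (add_mset e H)" if "mgraph {1..n} H" for H
    using that e by (auto simp: mgraph_def)
  \<comment> \<open>\<open>W\<close> bounds the time of playing on \<open>G\<close> as if \<open>e\<close> were present until the property holds with \<open>e\<close>,
    and repairing the missing edge from then on.\<close>
  define W where "W = (\<lambda>H. if P {1..n} (add_mset e H) then opt_time P n H else opt_time P n (add_mset e H) + ennreal c)"
  have W_le: "W H \<le> opt_time P n (add_mset e H) + ennreal c" if H: "mgraph {1..n} H" for H
  proof (cases "P {1..n} (add_mset e H)")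
    case True
    then have "rtime P n H \<le> c" using rep[OF E[OF H]] by blast
    then have "opt_time P n H \<le> ennreal c" by (subst ennreal_rtime[OF H, symmetric]) (rule ennreal_leI)
    then show ?thesis using True by (auto simp: W_def intro: add_increasing)
  qed (simp add: W_def)
  have "opt_time P n G \<le> W G"
  proof (rule opt_time_le_superharmonic[OF n _ G])
    fix H assume H: "mgraph {1..n} H" "\<not> P {1..n} H"
    show "1 + (\<Sum>u\<in>{1..n}. INF v\<in>{1..n}. W (add_mset (Upair u v) H)) / of_nat n \<le> W H"
    proof (cases "P {1..n} (add_mset e H)")
      \<comment> \<open>Once the property holds together with \<open>e\<close> it keeps doing so.
        From here on \<open>W\<close> is the optimal time itself, and the Bellman equation gives
        equality.\<close>
      case True
      have "W (add_mset (Upair u v) H) = opt_time P n (add_mset (Upair u v) H)" if "u \<in> {1..n}" "v \<in> {1..n}" for u v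
      proof -
        have "P {1..n} (add_mset (Upair u v) (add_mset e H))"
          by (intro mono_add[OF _ True] mgraph_add E H that)
        then show ?thesis by (simp add: W_def add_mset_commute)
      qed
      then have "1 + (\<Sum>u\<in>{1..n}. INF v\<in>{1..n}. W (add_mset (Upair u v) H)) / of_nat n =
          1 + (\<Sum>u\<in>{1..n}. INF v\<in>{1..n}. opt_time P n (add_mset (Upair u v) H)) / of_nat n" by simp
      also have "\<dots> = opt_time P n H"
        using H(2) opt_time_bellman[OF n, of P H] by (simp only: if_False)
      finally show ?thesis using True by (simp add: W_def)
    next
      case False
      let ?J = "\<lambda>u. INF v\<in>{1..n}. opt_time P n (add_mset (Upair u v) (add_mset e H))"
      \<comment> \<open>The move is the one that is optimal with \<open>e\<close> present. It may
        cross into the other branch of \<open>W\<close>, which is why the bound \<open>W_le\<close>,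
        valid in both branches, is used after it.\<close>
      have "(INF v\<in>{1..n}. W (add_mset (Upair u v) H)) \<le> ?J u + ennreal c" if u: "u \<in> {1..n}" for u
      proof -
        obtain v where v: "v \<in> {1..n}" "opt_time P n (add_mset (Upair u v) (add_mset e H)) = ?J u"
          using Min_image_attained[OF n, of "\<lambda>v. opt_time P n (add_mset (Upair u v) (add_mset e H))"] n
          by (subst (asm) Min_Inf) auto
        have "(INF v\<in>{1..n}. W (add_mset (Upair u v) H)) \<le> W (add_mset (Upair u v) H)"
          using v(1) by (rule INF_lower)
        also have "\<dots> \<le> ?J u + ennreal c"
          using W_le[OF mgraph_add[OF H(1) u v(1)]] unfolding v(2)[symmetric] by (simp add: add_mset_commute)
        finally show ?thesis .
      qed
      then have "1 + (\<Sum>u\<in>{1..n}. INF v\<in>{1..n}. W (add_mset (Upair u v) H)) / of_nat n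
          \<le> 1 + (\<Sum>u\<in>{1..n}. ?J u + ennreal c) / of_nat n"
        by (intro add_left_mono divide_right_mono_ennreal sum_mono)
      also have "\<dots> = 1 + (\<Sum>u\<in>{1..n}. ?J u) / of_nat n + ennreal c"
      proof -
        have "of_nat n * ennreal c / of_nat n = ennreal c"
          using n by (simp add: mult.commute ennreal_mult_divide_eq)
        then show ?thesis by (simp add: sum.distrib add_divide_distrib_ennreal add.assoc)
      qed
      also have "1 + (\<Sum>u\<in>{1..n}. ?J u) / of_nat n = opt_time P n (add_mset e H)"
        using False opt_time_bellman[OF n, of P "add_mset e H"] by (simp only: if_False)
      finally show ?thesis using False by (simp add: W_def)
    qed
  qed
  also have "W G \<le> opt_time P n (add_mset e G) + ennreal c" by (rule W_le[OF G])
  also have "\<dots> = ennreal (rtime P n (add_mset e G) + c)"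
    using \<open>0 \<le> c\<close> by (simp add: rtime_nonneg ennreal_rtime[OF Ge])
  finally show "rtime P n G \<le> rtime P n (add_mset e G) + c"
    unfolding rtime_def[of P n G] using \<open>0 \<le> c\<close> by (intro enn2real_leI) (simp add: rtime_nonneg)
qed (fact assms(1))

text \<open>The lower tail, for every strategy: whatever the circles, the remaining time drops by at
  most 1 on average and by at most \<open>c\<close> in any step, so Hoeffding's lemma controls how
  far it can run ahead of the clock.\<close>

lemma win_le_exp:
  assumes c: "lipschitz_const c" and "l > 0" and "mgraph {1..n} G"
  shows "win (P {1..n}) n k G \<le> exp (- l * (rtime P n G - real k) + real k * (l\<^sup>2 * c\<^sup>2 / 8))"
  using \<open>mgraph {1..n} G\<close>
proof (induction k arbitrary: G)
  case 0
  then show ?case using \<open>l > 0\<close> by (auto simp: rtime_eq_0)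
next
  case (Suc k)
  let ?B = "l\<^sup>2 * c\<^sup>2 / 8"
  show ?case
  proof (cases "P {1..n} G")
    case True
    have "0 \<le> l * real (Suc k) + real (Suc k) * ?B" using \<open>l > 0\<close> by (intro add_nonneg_nonneg mult_nonneg_nonneg) auto
    moreover have "- l * (0 - real (Suc k)) = l * real (Suc k)" by (simp only: diff_0 minus_mult_minus)
    ultimately have "0 \<le> - l * (0 - real (Suc k)) + real (Suc k) * ?B" by (simp only:)
    then show ?thesis using True by (simp only: rtime_eq_0 win.simps if_True one_le_exp_iff)
  next
    case False
    let ?r = "rtime P n G"
    define m where "m u = Min ((\<lambda>v. rtime P n (add_mset (Upair u v) G)) ` {1..n})" for u
    have r: "?r = 1 + (\<Sum>u\<in>{1..n}. m u) / real n"
      unfolding m_def by (rule rtime_bellman[OF Suc.prems False])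
    have m_bounds: "- m u \<in> {- ?r..- ?r + c}" if u: "u \<in> {1..n}" for u
    proof -
      obtain v where v: "v \<in> {1..n}" "rtime P n (add_mset (Upair u v) G) = m u"
        unfolding m_def using Min_image_attained[OF n, of "\<lambda>v. rtime P n (add_mset (Upair u v) G)"] by blast
      have "mgraph {1..n} (add_mset (Upair u v) G)" by (intro mgraph_add Suc.prems u v)
      then show ?thesis using c rtime_antimono[of G "add_mset (Upair u v) G"]
        unfolding lipschitz_const_def v(2)[symmetric] by force
    qed
    have "Max ((\<lambda>v. win (P {1..n}) n k (add_mset (Upair u v) G)) ` {1..n}) \<le> exp (- l * (m u - real k) + real k * ?B)"
      if u: "u \<in> {1..n}" for u
    proof -
      obtain v where v: "v \<in> {1..n}" "win (P {1..n}) n k (add_mset (Upair u v) G) = Max ((\<lambda>v. win (P {1..n}) n k (add_mset (Upair u v) G)) ` {1..n})"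
        using Max_image_attained[OF n, of "\<lambda>v. win (P {1..n}) n k (add_mset (Upair u v) G)"] by blast
      have "win (P {1..n}) n k (add_mset (Upair u v) G) \<le> exp (- l * (rtime P n (add_mset (Upair u v) G) - real k) + real k * ?B)"
        by (intro Suc.IH mgraph_add Suc.prems u v)
      also have "\<dots> \<le> exp (- l * (m u - real k) + real k * ?B)"
        unfolding m_def using v(1) \<open>l > 0\<close> by (auto intro!: Min_le)
      finally show ?thesis unfolding v(2) .
    qed
    then have "win (P {1..n}) n (Suc k) G \<le> (\<Sum>u\<in>{1..n}. exp (- l * (m u - real k) + real k * ?B)) / real n"
      using False by (auto intro!: divide_right_mono sum_mono)
    \<comment> \<open>The Bellman equation says that \<open>m\<close> has mean
      \<open>?r - 1\<close>. Centring \<open>- m u\<close> at its mean therefore pays for exactly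
      one step of the clock and turns \<open>k\<close> into \<open>Suc k\<close>.\<close>
    also have "\<dots> = (\<Sum>u\<in>{1..n}. exp (l * (- m u - (\<Sum>u\<in>{1..n}. - m u) / real n))) / real n * exp (- l * (?r - real (Suc k)) + real k * ?B)"
      unfolding r by (simp add: sum_distrib_right exp_add[symmetric] sum_negf algebra_simps)
    also have "\<dots> \<le> exp (l\<^sup>2 * (- ?r + c - - ?r)\<^sup>2 / 8) * exp (- l * (?r - real (Suc k)) + real k * ?B)"
      using m_bounds by (intro mult_right_mono Hoeffding_average n \<open>l > 0\<close>) auto
    also have "\<dots> = exp (- l * (?r - real (Suc k)) + real (Suc k) * ?B)"
      by (simp add: exp_add[symmetric] algebra_simps)
    finally show ?thesis .
  qed
qed

end

section \<open>Playing on blocks\<close>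

text \<open>Carries a block over to the standard vertex set \<open>{1..a}\<close>, on which the
  optimal times are defined; \<open>graph_property\<close> makes this harmless.\<close>

definition relabelled :: "(nat \<Rightarrow> nat) \<Rightarrow> nat set \<Rightarrow> edges \<Rightarrow> edges" where
  "relabelled f U G = image_mset (map_uprod f) (induced G U)"

lemma mgraph_induced: "finite U \<Longrightarrow> mgraph U (induced G U)"
  by (auto simp: mgraph_def induced_def)

lemma mgraph_relabelled:
  "bij_betw f U {1..a} \<Longrightarrow> mgraph {1..a} (relabelled f U G)"
  unfolding mgraph_def relabelled_def induced_def bij_betw_def by (auto simp: uprod.set_map)

lemma property_relabelled:
  assumes "graph_property P" "bij_betw f U {1..a}"
  shows "P {1..a} (relabelled f U G) = P U (induced G U)"
proof -
  have "finite U" using assms(2) bij_betw_finite by blast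
  then show ?thesis using assms mgraph_induced unfolding graph_property_def relabelled_def by blast
qed

lemma relabelled_empty [simp]: "relabelled f U {#} = {#}"
  by (simp add: relabelled_def induced_def)

lemma relabelled_add:
  "relabelled f U (add_mset (Upair u v) G) =
    (if u \<in> U \<and> v \<in> U then add_mset (Upair (f u) (f v)) (relabelled f U G) else relabelled f U G)"
  by (auto simp: relabelled_def induced_def)

context semi_random
begin

text \<open>When the process on \<open>{1..N}\<close> is played optimally inside a block \<open>U\<close> of size \<open>n\<close>, only one square in
  \<open>N / n\<close> falls into \<open>U\<close>. Hence \<open>N / n\<close> times the optimal remaining time of the block drops by one
  per step on average, and \<open>block_potential\<close> is a supermartingale by Hoeffding's lemma.\<close>

definition block_potential ::
    "real \<Rightarrow> real \<Rightarrow> nat \<Rightarrow> (nat \<Rightarrow> nat) \<Rightarrow> nat set \<Rightarrow> nat \<Rightarrow> edges \<Rightarrow> real" where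
  "block_potential l c N f U k G =
     (if P {1..n} (relabelled f U G) then 0
      else exp (l * (real N / real n * rtime P n (relabelled f U G) - real k)
                + real k * (l\<^sup>2 * (real N / real n * c)\<^sup>2 / 8)))"

lemma block_potential_nonneg: "0 \<le> block_potential l c N f U k G"
  by (simp add: block_potential_def)

text \<open>The claim covers every \<open>g\<close> that extends \<open>h\<close> suitably, rather
  than one \<open>g\<close>, so that the moves of two complementary blocks can be combined into a
  single rule serving both potentials.\<close>

lemma block_potential_step:
  assumes c: "lipschitz_const c" and "l > 0" and f: "bij_betw f U {1..n}" and U: "U \<subseteq> {1..N}"
  shows "\<exists>h. (\<forall>u\<in>U. h u \<in> U) \<and>
    (\<forall>g. (\<forall>u\<in>U. g u = h u) \<and> (\<forall>u\<in>{1..N} - U. g u \<notin> U) \<longrightarrow>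
      (\<Sum>u\<in>{1..N}. block_potential l c N f U k (add_mset (Upair u (g u)) G)) / real N
        \<le> block_potential l c N f U (Suc k) G)"
proof (cases "P {1..n} (relabelled f U G)")
  case True
  \<comment> \<open>A finished block stays finished, so any move inside \<open>U\<close> will
    do.\<close>
  let ?h = "\<lambda>u::nat. u"
  have "block_potential l c N f U k (add_mset (Upair u v) G) = 0" for u v
  proof -
    have "P {1..n} (relabelled f U (add_mset (Upair u v) G))"
      using mono_add[OF _ True, of "Upair (f u) (f v)"] mgraph_relabelled[OF f, of "add_mset (Upair u v) G"] True
      by (cases "u \<in> U \<and> v \<in> U") (auto simp only: relabelled_add if_True if_False simp_thms)
    then show ?thesis by (simp add: block_potential_def)
  qed
  then have "\<forall>g. (\<Sum>u\<in>{1..N}. block_potential l c N f U k (add_mset (Upair u (g u)) G)) / real N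
        \<le> block_potential l c N f U (Suc k) G"
    by (simp add: block_potential_nonneg)
  then show ?thesis by (intro exI[of _ ?h]) auto
next
  case False
  let ?H = "relabelled f U G"
  let ?r = "rtime P n ?H" and ?q = "real N / real n"
  let ?B = "l\<^sup>2 * (?q * c)\<^sup>2 / 8"
  have H: "mgraph {1..n} ?H" by (rule mgraph_relabelled[OF f])
  define m where "m w = Min ((\<lambda>v. rtime P n (add_mset (Upair w v) ?H)) ` {1..n})" for w
  have r: "?r = 1 + (\<Sum>w\<in>{1..n}. m w) / real n"
    unfolding m_def by (rule rtime_bellman[OF H False])
  have "finite U" and card: "card U = n" using f bij_betw_finite[OF f] bij_betw_same_card[OF f] by auto
  have "n \<le> N" using card_mono[OF _ U] card by simp
  then have N: "N \<ge> 1" using n by simp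
  have fU: "f u \<in> {1..n}" if "u \<in> U" for u using f that by (auto simp: bij_betw_def)
  have ex: "\<exists>v\<in>U. rtime P n (add_mset (Upair w (f v)) ?H) = m w" for w
  proof -
    obtain v where v: "v \<in> {1..n}" "rtime P n (add_mset (Upair w v) ?H) = m w"
      unfolding m_def using Min_image_attained[OF n, of "\<lambda>v. rtime P n (add_mset (Upair w v) ?H)"] by blast
    then obtain v' where "v' \<in> U" "f v' = v" using f unfolding bij_betw_def by (metis imageE)
    then show ?thesis using v by blast
  qed
  define h where "h u = (SOME v. v \<in> U \<and> rtime P n (add_mset (Upair (f u) (f v)) ?H) = m (f u))" for u
  have h: "h u \<in> U" "rtime P n (add_mset (Upair (f u) (f (h u))) ?H) = m (f u)" for u
    using someI_ex[of "\<lambda>v. v \<in> U \<and> rtime P n (add_mset (Upair (f u) (f v)) ?H) = m (f u)"] ex[of "f u"]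
    unfolding h_def by blast+
  have m_bounds: "?r - c \<le> m w \<and> m w \<le> ?r" if w: "w \<in> {1..n}" for w
  proof -
    obtain v where v: "v \<in> U" "rtime P n (add_mset (Upair w (f v)) ?H) = m w" using ex by blast
    have "mgraph {1..n} (add_mset (Upair w (f v)) ?H)" by (intro mgraph_add H w fU v)
    then show ?thesis using c rtime_antimono[of ?H "add_mset (Upair w (f v)) ?H"]
      unfolding lipschitz_const_def v(2)[symmetric] by force
  qed
  have "(\<Sum>u\<in>{1..N}. block_potential l c N f U k (add_mset (Upair u (g u)) G)) / real N
        \<le> block_potential l c N f U (Suc k) G"
    if g: "\<forall>u\<in>U. g u = h u" "\<forall>u\<in>{1..N} - U. g u \<notin> U" for g
  proof -
    \<comment> \<open>\<open>y u\<close> is the rescaled remaining time of the block after square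
      \<open>u\<close>; squares outside \<open>U\<close> leave it unchanged. Its mean is (N/n) (n (r
      - 1) + (N - n) r) / N = (N/n) r - 1, a drop of one per step.\<close>
    define y where "y u = ?q * (if u \<in> U then m (f u) else ?r)" for u
    have "0 \<le> c" using c by (simp add: lipschitz_const_def)
    have y: "y u \<in> {?q * (?r - c)..?q * ?r}" if "u \<in> {1..N}" for u
    proof -
      have "?r - c \<le> (if u \<in> U then m (f u) else ?r)" "(if u \<in> U then m (f u) else ?r) \<le> ?r"
        using m_bounds[OF fU[of u]] \<open>0 \<le> c\<close> by auto
      then have "?q * (?r - c) \<le> y u" "y u \<le> ?q * ?r"
        unfolding y_def by (intro mult_left_mono; simp)+
      then show ?thesis by (simp only: atLeastAtMost_iff)
    qed
    have "(\<Sum>u\<in>{1..N}. (if u \<in> U then m (f u) else ?r)) = (\<Sum>u\<in>U. m (f u)) + (\<Sum>u\<in>{1..N} - U. ?r)"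
      using U by (subst sum.subset_diff[OF U]) (auto intro!: arg_cong2[where f="(+)"] sum.cong)
    also have "(\<Sum>u\<in>U. m (f u)) = (\<Sum>w\<in>{1..n}. m w)"
      by (rule sum.reindex_bij_betw[OF f])
    also have "\<dots> = real n * (?r - 1)" using n by (subst r) simp
    also have "(\<Sum>u\<in>{1..N} - U. ?r) = (real N - real n) * ?r"
      using U card \<open>n \<le> N\<close> \<open>finite U\<close> by (simp add: card_Diff_subset of_nat_diff)
    finally have mean: "(\<Sum>u\<in>{1..N}. y u) / real N = ?q * ?r - 1"
      using n N unfolding y_def sum_distrib_left[symmetric] by (simp add: field_simps)
    \<comment> \<open>Only an inequality: the potential vanishes if this move completes the
      block.\<close>
    have "block_potential l c N f U k (add_mset (Upair u (g u)) G) \<le> exp (l * (y u - real k) + real k * ?B)"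
      if u: "u \<in> {1..N}" for u
    proof -
      have "?q * rtime P n (relabelled f U (add_mset (Upair u (g u)) G)) = y u"
        using g u h by (auto simp: relabelled_add y_def)
      then show ?thesis by (auto simp: block_potential_def)
    qed
    then have "(\<Sum>u\<in>{1..N}. block_potential l c N f U k (add_mset (Upair u (g u)) G)) / real N
      \<le> (\<Sum>u\<in>{1..N}. exp (l * (y u - real k) + real k * ?B)) / real N"
      by (intro divide_right_mono sum_mono) auto
    also have "\<dots> = (\<Sum>u\<in>{1..N}. exp (l * (y u - (\<Sum>u\<in>{1..N}. y u) / real N))) / real N
        * exp (l * (?q * ?r - real (Suc k)) + real k * ?B)"
      unfolding mean by (simp add: sum_distrib_right exp_add[symmetric] algebra_simps)
    also have "\<dots> \<le> exp (l\<^sup>2 * (?q * ?r - ?q * (?r - c))\<^sup>2 / 8) * exp (l * (?q * ?r - real (Suc k)) + real k * ?B)"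
      using y by (intro mult_right_mono Hoeffding_average N \<open>l > 0\<close>) auto
    also have "?q * ?r - ?q * (?r - c) = ?q * c" by (simp add: algebra_simps)
    also have "exp ?B * exp (l * (?q * ?r - real (Suc k)) + real k * ?B) = block_potential l c N f U (Suc k) G"
      using False by (simp add: block_potential_def exp_add[symmetric] algebra_simps)
    finally show ?thesis .
  qed
  then show ?thesis using h(1) by (intro exI[of _ h]) blast
qed

lemma block_potential_0:
  "\<not> P {1..n} (relabelled f U G) \<Longrightarrow> 0 \<le> l \<Longrightarrow> 1 \<le> block_potential l c N f U 0 G"
  by (simp add: block_potential_def rtime_nonneg)

lemma block_potential_empty_le:
  "block_potential l c N f U k {#} \<le>
    exp (l * (real N / real n * rtime P n {#} - real k) + real k * (l\<^sup>2 * (real N / real n * c)\<^sup>2 / 8))"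
  by (simp add: block_potential_def)

text \<open>The upper tail is the case of a single block consisting of all vertices, with the
  identity as relabelling and clock ratio 1.\<close>

lemma one_minus_win_le_exp:
  assumes gp: "graph_property P" and c: "lipschitz_const c" and "l > 0"
  shows "1 - win (P {1..n}) n k {#} \<le> exp (l * (rtime P n {#} - real k) + real k * (l\<^sup>2 * c\<^sup>2 / 8))"
proof -
  let ?f = "\<lambda>u. u" and ?U = "{1..n}"
  have f: "bij_betw ?f ?U {1..n}" by (simp add: bij_betw_def)
  have ind: "induced G ?U = G" if "mgraph ?U G" for G
    using that by (simp add: mgraph_def induced_def filter_mset_eq_conv)
  have "1 - win (P {1..n}) n k {#} \<le> block_potential l c n ?f ?U k {#}"
  proof (rule one_minus_win_le_potential[OF n])
    fix k G assume G: "mgraph {1..n} G" "\<not> P {1..n} G"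
    show "1 \<le> block_potential l c n ?f ?U 0 G"
      using G \<open>l > 0\<close> by (intro block_potential_0) (simp_all only: property_relabelled[OF gp f] ind less_imp_le not_False_eq_True)
    obtain h where h: "\<forall>u\<in>?U. h u \<in> ?U" and step: "\<forall>g. (\<forall>u\<in>?U. g u = h u) \<and> (\<forall>u\<in>{1..n} - ?U. g u \<notin> ?U) \<longrightarrow>
      (\<Sum>u\<in>{1..n}. block_potential l c n ?f ?U k (add_mset (Upair u (g u)) G)) / real n
        \<le> block_potential l c n ?f ?U (Suc k) G"
      using block_potential_step[OF c \<open>l > 0\<close> f, of n k G] by blast
    show "\<exists>g. (\<forall>u\<in>{1..n}. g u \<in> {1..n}) \<and> (\<Sum>u\<in>{1..n}. block_potential l c n ?f ?U k (add_mset (Upair u (g u)) G)) / real n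
        \<le> block_potential l c n ?f ?U (Suc k) G"
      using h step[rule_format, of h] by (intro exI[of _ h]) simp
  qed (simp_all add: block_potential_nonneg mgraph_def)
  also have "\<dots> \<le> exp (l * (real n / real n * rtime P n {#} - real k) + real k * (l\<^sup>2 * (real n / real n * c)\<^sup>2 / 8))"
    by (rule block_potential_empty_le)
  finally show ?thesis using n by simp
qed

end

text \<open>The sum of the two block potentials is a potential for finishing both blocks, which
  amounts to a union bound. If both are finished after \<open>k\<close> steps, \<open>D\<close> pays
  for the merging; otherwise the player starts over, at a cost of at most
  \<open>rtime P N {#}\<close> by monotonicity.\<close>

lemma rtime_le_merge:
  assumes N: "N = a + b" and gp: "graph_property P"
    and sN: "semi_random P N" and sa: "semi_random P a" and sb: "semi_random P b"
    and ca: "semi_random.lipschitz_const P a ca" and cb: "semi_random.lipschitz_const P b cb" and "l > 0"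
    and D: "0 \<le> D" "\<And>G. mgraph {1..N} G \<Longrightarrow> P {1..a} (induced G {1..a}) \<Longrightarrow> P {a+1..N} (induced G {a+1..N}) \<Longrightarrow> rtime P N G \<le> D"
  shows "rtime P N {#} \<le> real k + D +
    (exp (l * (real N / real a * rtime P a {#} - real k) + real k * (l\<^sup>2 * (real N / real a * ca)\<^sup>2 / 8))
   + exp (l * (real N / real b * rtime P b {#} - real k) + real k * (l\<^sup>2 * (real N / real b * cb)\<^sup>2 / 8))) * rtime P N {#}"
proof -
  interpret N: semi_random P N by (rule sN)
  interpret a: semi_random P a by (rule sa)
  interpret b: semi_random P b by (rule sb)
  let ?A = "{1..a}" and ?B = "{a+1..N}"
  let ?fa = "\<lambda>u::nat. u" and ?fb = "\<lambda>u. u - a"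
  have fa: "bij_betw ?fa ?A {1..a}" by (simp add: bij_betw_def)
  have fb: "bij_betw ?fb ?B {1..b}"
    by (rule bij_betw_byWitness[where f'="\<lambda>u. u + a"]) (use N in auto)
  define Q where "Q G = (P ?A (induced G ?A) \<and> P ?B (induced G ?B))" for G
  define \<phi>a where "\<phi>a = a.block_potential l ca N ?fa ?A"
  define \<phi>b where "\<phi>b = b.block_potential l cb N ?fb ?B"
  have AB: "{1..N} - ?A = ?B" "{1..N} - ?B = ?A" "?A \<subseteq> {1..N}" "?B \<subseteq> {1..N}" "?A \<inter> ?B = {}" using N by auto
  have "1 - win Q N k {#} \<le> \<phi>a k {#} + \<phi>b k {#}"
  proof (rule one_minus_win_le_potential[OF N.n, where \<phi>="\<lambda>k G. \<phi>a k G + \<phi>b k G"])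
    fix k G
    show "0 \<le> \<phi>a k G + \<phi>b k G"
      unfolding \<phi>a_def \<phi>b_def by (intro add_nonneg_nonneg a.block_potential_nonneg b.block_potential_nonneg)
    assume G: "\<not> Q G"
    then have "1 \<le> \<phi>a 0 G \<or> 1 \<le> \<phi>b 0 G"
      unfolding Q_def \<phi>a_def \<phi>b_def
      using a.block_potential_0[of ?fa ?A G l ca N] b.block_potential_0[of ?fb ?B G l cb N] \<open>l > 0\<close>
        property_relabelled[OF gp fa, of G] property_relabelled[OF gp fb, of G] by auto
    then show "1 \<le> \<phi>a 0 G + \<phi>b 0 G"
      using a.block_potential_nonneg b.block_potential_nonneg unfolding \<phi>a_def \<phi>b_def by (smt (verit))
    obtain ha where ha: "\<forall>u\<in>?A. ha u \<in> ?A" "\<forall>g. (\<forall>u\<in>?A. g u = ha u) \<and> (\<forall>u\<in>?B. g u \<notin> ?A) \<longrightarrow>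
      (\<Sum>u\<in>{1..N}. \<phi>a k (add_mset (Upair u (g u)) G)) / real N \<le> \<phi>a (Suc k) G"
      using a.block_potential_step[OF ca \<open>l > 0\<close> fa AB(3), of k G] unfolding AB \<phi>a_def by blast
    obtain hb where hb: "\<forall>u\<in>?B. hb u \<in> ?B" "\<forall>g. (\<forall>u\<in>?B. g u = hb u) \<and> (\<forall>u\<in>?A. g u \<notin> ?B) \<longrightarrow>
      (\<Sum>u\<in>{1..N}. \<phi>b k (add_mset (Upair u (g u)) G)) / real N \<le> \<phi>b (Suc k) G"
      using b.block_potential_step[OF cb \<open>l > 0\<close> fb AB(4), of k G] unfolding AB \<phi>b_def by blast
    \<comment> \<open>Square and circle always lie in the same block, so this rule is admissible for
      both potentials.\<close>
    let ?g = "\<lambda>u. if u \<in> ?A then ha u else hb u"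
    have "\<forall>u\<in>{1..N}. ?g u \<in> {1..N}" using ha(1) hb(1) AB by (auto simp: N)
    moreover have "(\<Sum>u\<in>{1..N}. \<phi>a k (add_mset (Upair u (?g u)) G)) / real N \<le> \<phi>a (Suc k) G"
      using hb(1) by (intro ha(2)[rule_format]) auto
    moreover have "(\<Sum>u\<in>{1..N}. \<phi>b k (add_mset (Upair u (?g u)) G)) / real N \<le> \<phi>b (Suc k) G"
      using ha(1) by (intro hb(2)[rule_format]) auto
    ultimately show "\<exists>g. (\<forall>u\<in>{1..N}. g u \<in> {1..N}) \<and>
       (\<Sum>u\<in>{1..N}. \<phi>a k (add_mset (Upair u (g u)) G) + \<phi>b k (add_mset (Upair u (g u)) G)) / real N \<le> \<phi>a (Suc k) G + \<phi>b (Suc k) G"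
      by (intro exI[of _ ?g]) (simp add: sum.distrib add_divide_distrib)
  qed (simp add: mgraph_def)
  also have "\<dots> \<le> exp (l * (real N / real a * rtime P a {#} - real k) + real k * (l\<^sup>2 * (real N / real a * ca)\<^sup>2 / 8))
   + exp (l * (real N / real b * rtime P b {#} - real k) + real k * (l\<^sup>2 * (real N / real b * cb)\<^sup>2 / 8))"
    unfolding \<phi>a_def \<phi>b_def by (intro add_mono a.block_potential_empty_le b.block_potential_empty_le)
  finally have win: "1 - win Q N k {#} \<le> \<dots>" .
  have "rtime P N {#} \<le> real k + D + (1 - win Q N k {#}) * rtime P N {#}"
    by (rule N.rtime_le_win) (auto simp: N.rtime_nonneg D Q_def mgraph_def[of _ "{#}"] intro!: D(2) N.rtime_antimono)
  also have "\<dots> \<le> real k + D +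
    (exp (l * (real N / real a * rtime P a {#} - real k) + real k * (l\<^sup>2 * (real N / real a * ca)\<^sup>2 / 8))
   + exp (l * (real N / real b * rtime P b {#} - real k) + real k * (l\<^sup>2 * (real N / real b * cb)\<^sup>2 / 8))) * rtime P N {#}"
    by (intro add_left_mono mult_right_mono win N.rtime_nonneg)
  finally show ?thesis .
qed

section \<open>Consequences of replaceability and linearity\<close>

context semi_random
begin

text \<open>The \<open>LEAST\<close> in the definition means something only if some time meets all
  its conditions. The first time at which success probability 1/2 is attainable does; it is not 0
  because the empty graph fails the property.\<close>

lemma median_time_bounds:
  assumes "rtime P n {#} > 0"
  shows "1 \<le> median_time P n" "real (median_time P n) \<le> 2 * rtime P n {#} + 2"
proof -
  let ?pw = "\<lambda>S t. prob_within P n {#} S t"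
  let ?R = "\<lambda>t. \<exists>S\<in>strategies n. ?pw S (real t) \<ge> 1/2"
  let ?M = "\<lambda>t. 1 \<le> t \<and> (\<exists>S\<in>strategies n. ?pw S (real t) \<ge> 1/2) \<and> (\<forall>S\<in>strategies n. ?pw S (real t - 1) < 1/2)"
  \<comment> \<open>By Markov's inequality twice the expected time suffices for success probability
    1/2; the extra 1 makes \<open>k\<close> positive.\<close>
  define k where "k = nat \<lceil>2 * rtime P n {#}\<rceil> + 1"
  have k: "2 * rtime P n {#} \<le> real k" "real k \<le> 2 * rtime P n {#} + 2" "k \<ge> 1"
    using rtime_nonneg[of "{#}"] unfolding k_def by linarith+
  have "real k * (1 - win (P {1..n}) n k {#}) \<le> real k * (1/2)"
    using one_minus_win_markov[of k] k(1) by simp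
  then have "win (P {1..n}) n k {#} \<ge> 1/2" using k(3) by (subst (asm) mult_le_cancel_left_pos) auto
  then have "?R k" using win_attained[OF n, of P "{#}" k] by metis
  define t where "t = (LEAST t. ?R t)"
  have t: "?R t" unfolding t_def by (rule LeastI[of ?R k]) fact
  have "t \<le> k" unfolding t_def by (rule Least_le) fact
  have "\<not> P {1..n} {#}" using assms rtime_eq_0[of "{#}"] by auto
  then have "?pw S (real 0) = 0" for S by (simp only: prob_within_0 if_False)
  then have "t \<noteq> 0" using t by (metis not_one_le_zero half_gt_zero_iff zero_less_one not_le)
  have "?pw S (real t - 1) < 1/2" if "S \<in> strategies n" for S
  proof -
    have "\<not> ?R (t - 1)" using \<open>t \<noteq> 0\<close> unfolding t_def by (intro not_less_Least) simp
    then show ?thesis using that \<open>t \<noteq> 0\<close> by (simp add: of_nat_diff not_le)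
  qed
  then have "?M t" using t \<open>t \<noteq> 0\<close> by auto
  then have "?M (LEAST t. ?M t)" and "(LEAST t. ?M t) \<le> t" by (rule LeastI, rule Least_le)
  then show "1 \<le> median_time P n" "real (median_time P n) \<le> 2 * rtime P n {#} + 2"
    unfolding quantile_time_def using \<open>t \<le> k\<close> k(2) by auto
qed

lemma lipschitz_const_mono:
  assumes "lipschitz_const c" "c \<le> d" shows "lipschitz_const d"
  unfolding lipschitz_const_def
proof (intro conjI allI impI)
  show "0 \<le> d" using assms unfolding lipschitz_const_def by simp
  fix G e assume "mgraph {1..n} (add_mset e G)"
  then have "rtime P n G \<le> rtime P n (add_mset e G) + c"
    using assms(1) unfolding lipschitz_const_def by blast
  then show "rtime P n G \<le> rtime P n (add_mset e G) + d" using assms(2) by simp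
qed

text \<open>A repair that succeeds with probability at least 1/2 costs at most twice its length in
  expectation when failures are restarted; hence the factor 2.\<close>

lemma lipschitz_const_of_replaceable:
  assumes "0 \<le> s" and "err \<le> 1/2"
    and rep: "\<And>G e. mgraph {1..n} G \<Longrightarrow> P {1..n} G \<Longrightarrow> e \<in># G \<Longrightarrow>
      \<exists>S\<in>strategies n. prob_within P n (G - {#e#}) S s \<ge> 1 - err"
  shows "lipschitz_const (2 * s)"
proof (rule lipschitz_constI)
  fix G e assume G: "mgraph {1..n} (add_mset e G)" "P {1..n} (add_mset e G)"
  obtain S where S: "S \<in> strategies n" "prob_within P n G S s \<ge> 1 - err"
    using rep[OF G, of e] by auto
  let ?k = "nat \<lfloor>s\<rfloor>"
  have "1/2 \<le> prob_within P n G S (real ?k)"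
    using S(2) \<open>err \<le> 1/2\<close> unfolding prob_within_floor[OF \<open>0 \<le> s\<close>] by linarith
  also have "\<dots> \<le> win (P {1..n}) n ?k G" by (rule prob_within_le_win[OF n S(1)])
  finally have "rtime P n G \<le> 2 * real ?k"
    using G(1) by (intro rtime_le_of_win_half) (auto simp: mgraph_def)
  also have "\<dots> \<le> 2 * s" using \<open>0 \<le> s\<close> by simp
  finally show "rtime P n G \<le> 2 * s" .
qed (use assms(1) in simp)

end

lemma linear_replaceable_bounds:
  assumes "\<alpha> > 0" "edge_replaceable (\<lambda>n. real n powr \<alpha>) P" "linear_property P" "monotone_increasing P"
  obtains \<beta> c1 c2 K n0 where "0 < \<beta>" "\<beta> \<le> 1/2" "0 < c1" "0 < c2" "0 \<le> K"
    "\<And>n. n \<ge> n0 \<Longrightarrow> semi_random P n"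
    "\<And>n. n \<ge> n0 \<Longrightarrow> c1 * real n \<le> rtime P n {#}" "\<And>n. n \<ge> n0 \<Longrightarrow> rtime P n {#} \<le> c2 * real n"
    "\<And>n. n \<ge> n0 \<Longrightarrow> semi_random.lipschitz_const P n (K * real n powr (1/2 - \<beta>))"
proof -
  \<comment> \<open>The cap at 1/2 keeps the exponent \<open>1/2 - \<beta>\<close> nonnegative, so a
    block's Lipschitz bound is at most that of the whole graph.\<close>
  define \<beta> where "\<beta> = min \<alpha> (1/2)"
  have \<beta>: "0 < \<beta>" "\<beta> \<le> 1/2" "\<beta> \<le> \<alpha>" using \<open>\<alpha> > 0\<close> by (auto simp: \<beta>_def)
  obtain err where err: "err \<in> o(\<lambda>n. 1 / sqrt (real (median_time P n)))"
    and rep: "\<And>n G e. n \<ge> 1 \<Longrightarrow> mgraph {1..n} G \<Longrightarrow> P {1..n} G \<Longrightarrow> e \<in># G \<Longrightarrow>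
      \<exists>S\<in>strategies n. prob_within P n (G - {#e#}) S (sqrt (real (median_time P n)) / real n powr \<alpha>) \<ge> 1 - err n"
    using assms(2) unfolding edge_replaceable_def by blast
  have I: "enn2real (optimal_time P n) = rtime P n {#}" for n by (simp add: rtime_def optimal_time_eq)
  have "(\<lambda>n. rtime P n {#}) \<in> \<Theta>(\<lambda>n. real n)" using assms(3) unfolding linear_property_def I .
  then have "(\<lambda>n. rtime P n {#}) \<in> O(\<lambda>n. real n)" "(\<lambda>n. rtime P n {#}) \<in> \<Omega>(\<lambda>n. real n)" by auto
  then obtain c2 c1 where "c2 > 0" "c1 > 0" and
    c2: "\<forall>\<^sub>F n in sequentially. norm (rtime P n {#}) \<le> c2 * norm (real n)" and
    c1: "\<forall>\<^sub>F n in sequentially. norm (rtime P n {#}) \<ge> c1 * norm (real n)"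
    by (elim landau_o.bigE landau_omega.bigE) blast
  have err2: "\<forall>\<^sub>F n in sequentially. norm (err n) \<le> 1/2 * norm (1 / sqrt (real (median_time P n)))"
    using err by (intro landau_o.smallD) auto
  have rn: "norm (rtime P n {#}) = rtime P n {#}" for n by (simp add: rtime_def)
  \<comment> \<open>The 2 comes from restarting, and m* is at most \<open>2 * c2 * n + 2\<close>,
    hence at most \<open>(2 * c2 + 2) * n\<close>.\<close>
  define K where "K = 2 * sqrt (2 * c2 + 2)"
  have "\<forall>\<^sub>F n in sequentially. semi_random P n \<and> c1 * real n \<le> rtime P n {#} \<and> rtime P n {#} \<le> c2 * real n \<and>
      semi_random.lipschitz_const P n (K * real n powr (1/2 - \<beta>))"
    using c1 c2 err2 eventually_ge_at_top[of 1]
  proof eventually_elim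
    case (elim n)
    have pos: "rtime P n {#} > 0"
    proof -
      have "0 < c1 * real n" using \<open>c1 > 0\<close> elim(4) by simp
      then show ?thesis using elim(1) rn by simp
    qed
    \<comment> \<open>An infinite optimal time would be read as 0, contradicting the linear lower
      bound.\<close>
    have "opt_time P n {#} < top" using pos unfolding rtime_def by (cases "opt_time P n {#}") auto
    then interpret semi_random P n using elim(4) assms(4) by unfold_locales
    let ?m = "real (median_time P n)"
    let ?s = "sqrt ?m / real n powr \<alpha>"
    note m = median_time_bounds[OF pos]
    have "err n \<le> 1/2"
    proof -
      have "1 / sqrt ?m \<le> 1" using m(1) by simp
      then show ?thesis using elim(3) by (simp del: real_sqrt_ge_1_iff)
    qed
    then have lip: "lipschitz_const (2 * ?s)"
      using elim(4) by (intro lipschitz_const_of_replaceable[where err="err n"] rep) auto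
    have "?m \<le> 2 * (c2 * real n) + 2" using m(2) elim(2) rn by simp
    also have "\<dots> \<le> (2 * c2 + 2) * real n" using elim(4) by (simp add: algebra_simps)
    finally have "sqrt ?m \<le> sqrt ((2 * c2 + 2) * real n)" by (rule real_sqrt_le_mono)
    then have "2 * ?s \<le> 2 * (sqrt ((2 * c2 + 2) * real n) / real n powr \<alpha>)"
      by (intro mult_left_mono divide_right_mono) auto
    also have "\<dots> = K * (real n powr (1/2) / real n powr \<alpha>)"
      by (simp add: K_def real_sqrt_mult powr_half_sqrt)
    also have "\<dots> = K * real n powr (1/2 - \<alpha>)" by (simp add: powr_diff)
    also have "\<dots> \<le> K * real n powr (1/2 - \<beta>)"
      using \<beta> elim(4) \<open>c2 > 0\<close> by (intro mult_left_mono powr_mono) (auto simp: K_def)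
    finally have "2 * ?s \<le> K * real n powr (1/2 - \<beta>)" .
    then have "lipschitz_const (K * real n powr (1/2 - \<beta>))"
      by (rule lipschitz_const_mono[OF lip])
    then show ?case using elim rn semi_random_axioms by simp
  qed
  then obtain n0 where "\<And>n. n \<ge> n0 \<Longrightarrow> semi_random P n \<and> c1 * real n \<le> rtime P n {#} \<and> rtime P n {#} \<le> c2 * real n \<and>
      semi_random.lipschitz_const P n (K * real n powr (1/2 - \<beta>))"
    unfolding eventually_sequentially by blast
  moreover have "0 \<le> K" using \<open>c2 > 0\<close> by (simp add: K_def)
  ultimately show ?thesis using that[of \<beta> c1 c2 K n0] \<beta> \<open>c1 > 0\<close> \<open>c2 > 0\<close> by blast
qed

section \<open>Sequences that are nearly subadditive in ratio\<close>

text \<open>Think of \<open>q * m + r\<close> vertices as \<open>q\<close> blocks, \<open>r\<close>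
  of size \<open>m + 1\<close> and the others of size \<open>m\<close>, and halve \<open>q\<close>
  repeatedly. The factor \<open>2 - real q powr (- g)\<close> makes the errors telescope: it grows
  at each merge by enough to absorb the new error, yet stays below 2.\<close>

lemma iterated_merge_bound:
  fixes f :: "nat \<Rightarrow> real"
  assumes "0 < g" "0 \<le> K" "m \<ge> 1" "m \<ge> n1"
    and merge: "\<And>a b. a + b \<ge> n1 \<Longrightarrow> a + b \<le> 6 * a \<Longrightarrow> a + b \<le> 6 * b \<Longrightarrow>
      f (a + b) \<le> max (f a) (f b) + K * real (a + b) powr (- g)"
    and "1 \<le> q" "r \<le> q"
  shows "f (q * m + r) \<le> max (f m) (f (m + 1)) + K / ((4/3) powr g - 1) * real m powr (- g) * (2 - real q powr (- g))"
  using \<open>1 \<le> q\<close> \<open>r \<le> q\<close>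
proof (induction q arbitrary: r rule: less_induct)
  case (less q)
  let ?H = "K / ((4/3) powr g - 1)" and ?X = "max (f m) (f (m + 1))"
  have gt1: "(4/3) powr g > 1" using powr_less_mono[of 0 g "4/3"] \<open>0 < g\<close> by simp
  then have H: "?H \<ge> 0" using \<open>0 \<le> K\<close> by simp
  show ?case
  proof (cases "q = 1")
    case True
    then have "r = 0 \<or> r = 1" using less.prems by auto
    then have "f (q * m + r) \<le> ?X" using True by auto
    moreover have "0 \<le> ?H * real m powr (- g) * (2 - real q powr (- g))"
      using H by (intro mult_nonneg_nonneg) (auto simp: True)
    ultimately show ?thesis by linarith
  next
    case False
    \<comment> \<open>The larger blocks go to the first half as long as there is room; this gives
      \<open>r1 \<le> q1\<close> and \<open>r2 \<le> q2\<close>.\<close>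
    define q1 q2 r1 r2 where "q1 = q div 2" and "q2 = q - q div 2" and "r1 = min r q1" and "r2 = r - min r q1"
    have q: "1 \<le> q1" "q1 \<le> q2" "q1 < q" "q2 < q" "q1 + q2 = q" "q \<le> 3 * q1" "4 * q2 \<le> 3 * q"
      "r1 \<le> q1" "r2 \<le> q2" "r1 + r2 = r"
      using less.prems False unfolding q1_def q2_def r1_def r2_def by presburger+
    let ?a = "q1 * m + r1" and ?b = "q2 * m + r2"
    have ab: "?a + ?b = q * m + r" using q by (metis add.assoc add.left_commute distrib_right)
    \<comment> \<open>The origin of the constant 6: a factor 2 since
      \<open>r \<le> q \<le> q * m\<close>, and a factor 3 since the smaller half of
      \<open>q\<close> is at least q/3, with equality at q = 3.\<close>
    have "q * m + r \<le> q * m + q * m" using less.prems \<open>m \<ge> 1\<close> by (intro add_left_mono order_trans[OF less.prems(2)]) simp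
    also have "\<dots> \<le> 2 * (3 * q1 * m)" using mult_le_mono1[OF q(6), of m] by linarith
    finally have 6: "?a + ?b \<le> 6 * (q1 * m)" unfolding ab by simp
    have b: "q1 * m \<le> q2 * m" using q(2) by simp
    have "n1 \<le> q * m" using \<open>m \<ge> n1\<close> less.prems(1) by (metis le_trans mult_le_mono1 nat_mult_1)
    then have "n1 \<le> ?a + ?b" unfolding ab by simp
    moreover have "?a + ?b \<le> 6 * ?a" by (rule order_trans[OF 6]) simp
    moreover have "?a + ?b \<le> 6 * ?b" by (rule order_trans[OF 6], intro mult_le_mono2 trans_le_add1 b)
    ultimately have "f (?a + ?b) \<le> max (f ?a) (f ?b) + K * real (?a + ?b) powr (- g)"
      by (rule merge)
    moreover have "max (f ?a) (f ?b) \<le> ?X + ?H * real m powr (- g) * (2 - real q2 powr (- g))"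
    proof -
      have "real q2 powr (- g) \<le> real q1 powr (- g)"
        using q(1,2) \<open>0 < g\<close> by (intro powr_mono2') auto
      then have "?H * real m powr (- g) * (2 - real q1 powr (- g)) \<le> ?H * real m powr (- g) * (2 - real q2 powr (- g))"
        using H by (intro mult_left_mono mult_nonneg_nonneg) auto
      moreover have "f ?a \<le> ?X + ?H * real m powr (- g) * (2 - real q1 powr (- g))"
        using q by (intro less.IH) auto
      moreover have "f ?b \<le> ?X + ?H * real m powr (- g) * (2 - real q2 powr (- g))"
        using q by (intro less.IH) auto
      ultimately show ?thesis by simp
    qed
    moreover have "K * real (?a + ?b) powr (- g) \<le> ?H * real m powr (- g) * (real q2 powr (- g) - real q powr (- g))"
    proof -
      have "real (?a + ?b) powr (- g) \<le> real (q * m) powr (- g)"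
        unfolding ab using less.prems \<open>m \<ge> 1\<close> \<open>0 < g\<close> by (intro powr_mono2') (auto simp del: of_nat_mult)
      also have "\<dots> = real q powr (- g) * real m powr (- g)" by (simp add: powr_mult)
      finally have "K * real (?a + ?b) powr (- g) \<le> K * (real q powr (- g) * real m powr (- g))"
        using \<open>0 \<le> K\<close> by (rule mult_left_mono)
      also have "\<dots> = ?H * real m powr (- g) * (((4/3) powr g - 1) * real q powr (- g))"
        using gt1 \<open>0 < g\<close> by simp
      also have "\<dots> \<le> ?H * real m powr (- g) * (real q2 powr (- g) - real q powr (- g))"
      proof -
        \<comment> \<open>The larger half has at most 3q/4 blocks, which explains the denominator
          \<open>(4/3) powr g - 1\<close>.\<close>
        have "(3/4 * real q) powr (- g) \<le> real q2 powr (- g)"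
          using q \<open>0 < g\<close> by (intro powr_mono2') auto
        moreover have "(3/4 * real q) powr (- g) = (4/3) powr g * real q powr (- g)"
          by (simp add: powr_mult powr_minus powr_divide field_simps)
        ultimately have "((4/3) powr g - 1) * real q powr (- g) \<le> real q2 powr (- g) - real q powr (- g)"
          by (simp add: algebra_simps)
        then show ?thesis using H by (intro mult_left_mono mult_nonneg_nonneg) auto
      qed
      finally show ?thesis .
    qed
    ultimately show ?thesis unfolding ab by (simp only: right_diff_distrib)
  qed
qed

text \<open>As in Fekete's lemma the limit is an infimum, here of \<open>f m + \<eta> m\<close>: a
  nearly minimal \<open>m\<close> bounds all large \<open>N\<close> from above, and
  \<open>f N \<ge> L - \<eta> N\<close> bounds them from below.\<close>

lemma convergent_of_quasi_monotone:
  fixes f \<eta> :: "nat \<Rightarrow> real"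
  assumes f: "\<And>m. m \<ge> k \<Longrightarrow> 0 \<le> f m" and \<eta>: "\<And>m. 0 \<le> \<eta> m" "\<eta> \<longlonglongrightarrow> 0"
    and le: "\<And>m N. m \<ge> k \<Longrightarrow> m * m \<le> N \<Longrightarrow> f N \<le> f m + \<eta> m"
  shows "convergent f"
proof -
  define L where "L = (INF m\<in>{k..}. f m + \<eta> m)"
  have bdd: "bdd_below ((\<lambda>m. f m + \<eta> m) ` {k..})" using f \<eta>(1) by (intro bdd_belowI2[of _ 0]) auto
  have "f \<longlonglongrightarrow> L"
  proof (rule LIMSEQ_I)
    fix e :: real assume "e > 0"
    then have "L < L + e" by simp
    then obtain m where m: "m \<ge> k" "f m + \<eta> m < L + e"
      unfolding L_def using cInf_lessD[of "(\<lambda>m. f m + \<eta> m) ` {k..}" "L + e"] unfolding L_def by auto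
    obtain n2 where n2: "\<And>N. N \<ge> n2 \<Longrightarrow> norm (\<eta> N - 0) < e" using LIMSEQ_D[OF \<eta>(2) \<open>e > 0\<close>] by blast
    have "norm (f N - L) < e" if "N \<ge> max (m * m) (max n2 k)" for N
    proof -
      have "f N < L + e" using le[OF m(1), of N] m(2) that by simp
      moreover have "L \<le> f N + \<eta> N" unfolding L_def using bdd that by (intro cINF_lower) auto
      ultimately show ?thesis using n2[of N] that by simp
    qed
    then show "\<exists>no. \<forall>N\<ge>no. norm (f N - L) < e" by blast
  qed
  then show ?thesis by (rule convergentI)
qed

lemma convergent_of_merge:
  fixes f :: "nat \<Rightarrow> real"
  assumes "0 < g" "0 \<le> K"
    and merge: "\<And>a b. a + b \<ge> n1 \<Longrightarrow> a + b \<le> 6 * a \<Longrightarrow> a + b \<le> 6 * b \<Longrightarrow>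
      f (a + b) \<le> max (f a) (f b) + K * real (a + b) powr (- g)"
    and f: "\<And>m. m \<ge> n1 \<Longrightarrow> 0 \<le> f m"
    and \<epsilon>: "\<And>m. 0 \<le> \<epsilon> m" "\<epsilon> \<longlonglongrightarrow> 0" "\<And>m. m \<ge> n1 \<Longrightarrow> f (m + 1) \<le> f m + \<epsilon> m"
  shows "convergent f"
proof -
  let ?H = "K / ((4/3) powr g - 1)"
  have gt1: "(4/3) powr g > 1" using powr_less_mono[of 0 g "4/3"] \<open>0 < g\<close> by simp
  then have H: "?H \<ge> 0" using \<open>0 \<le> K\<close> by simp
  let ?\<eta> = "\<lambda>m. \<epsilon> m + 2 * ?H * real m powr (- g)"
  have nn: "0 \<le> ?\<eta> m" for m using \<epsilon>(1) H by (intro add_nonneg_nonneg mult_nonneg_nonneg) auto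
  have "(\<lambda>m. real m powr (- g)) \<longlonglongrightarrow> 0"
    using \<open>0 < g\<close> by (intro tendsto_neg_powr filterlim_real_sequentially) simp
  then have "(\<lambda>m. \<epsilon> m + 2 * ?H * real m powr (- g)) \<longlonglongrightarrow> 0 + 2 * ?H * 0"
    by (intro tendsto_add tendsto_mult tendsto_const \<epsilon>(2))
  then have lim: "?\<eta> \<longlonglongrightarrow> 0" by simp
  show ?thesis
  proof (rule convergent_of_quasi_monotone[where k="max n1 1", OF _ nn lim])
    fix m N assume m: "max n1 1 \<le> m" "m * m \<le> N"
    define q r where "q = N div m" and "r = N mod m"
    have N: "N = q * m + r" unfolding q_def r_def by simp
    \<comment> \<open>This is the purpose of \<open>m * m \<le> N\<close>: the quotient is at least
      \<open>m\<close> and so exceeds the remainder, as the division into blocks of sizes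
      \<open>m\<close> and \<open>m + 1\<close> requires.\<close>
    have "m \<le> q" unfolding q_def using m by (metis div_le_mono max.bounded_iff nonzero_mult_div_cancel_right not_one_le_zero)
    moreover have "r < m" unfolding r_def using m by simp
    ultimately have "1 \<le> q" "r \<le> q" using m by auto
    then have "f N \<le> max (f m) (f (m + 1)) + ?H * real m powr (- g) * (2 - real q powr (- g))"
      unfolding N using m by (intro iterated_merge_bound[OF assms(1,2) _ _ merge]) auto
    also have "\<dots> \<le> (f m + \<epsilon> m) + ?H * real m powr (- g) * 2"
      using \<epsilon>(3)[of m] \<epsilon>(1)[of m] m H by (intro add_mono mult_left_mono mult_nonneg_nonneg) auto
    finally show "f N \<le> f m + ?\<eta> m" by (simp add: mult_ac)
  qed (use f in auto)
qed

section \<open>The limit and the threshold\<close>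

text \<open>The tilt \<open>real N powr (\<beta> - 1)\<close> is the largest power for which the
  second-order term stays bounded: over order N steps its exponents are 1 + 2(\<beta> - 1) + 2(1/2 -
  \<beta>) = 0. The clock ratio contributes 36/8, rounded up to 5.\<close>

lemma hoeffding_exponent_bound:
  fixes n N :: nat and A K \<beta> k :: real
  assumes "1 \<le> n" "n \<le> N" "N \<le> 6 * n" "\<beta> \<le> 1/2" "0 \<le> K" "0 \<le> k" "k \<le> A * real N"
  shows "k * ((real N powr (\<beta> - 1))\<^sup>2 * (real N / real n * (K * real n powr (1/2 - \<beta>)))\<^sup>2 / 8) \<le> 5 * A * K\<^sup>2"
proof -
  have N: "real N > 0" "real n > 0" using assms by auto
  have "real N / real n \<le> 6" using assms N by (simp add: divide_le_eq)
  moreover have "real n powr (1/2 - \<beta>) \<le> real N powr (1/2 - \<beta>)"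
    using assms by (intro powr_mono2) auto
  ultimately have "real N / real n * (K * real n powr (1/2 - \<beta>)) \<le> 6 * (K * real N powr (1/2 - \<beta>))"
    using \<open>0 \<le> K\<close> by (intro mult_mono) auto
  then have "(real N / real n * (K * real n powr (1/2 - \<beta>)))\<^sup>2 \<le> (6 * (K * real N powr (1/2 - \<beta>)))\<^sup>2"
    using \<open>0 \<le> K\<close> by (intro power_mono) auto
  moreover have "0 \<le> A" using \<open>0 \<le> k\<close> \<open>k \<le> A * real N\<close> N by (metis order_trans zero_le_mult_iff not_less)
  ultimately have "k * ((real N powr (\<beta> - 1))\<^sup>2 * (real N / real n * (K * real n powr (1/2 - \<beta>)))\<^sup>2 / 8)
     \<le> (A * real N) * ((real N powr (\<beta> - 1))\<^sup>2 * (6 * (K * real N powr (1/2 - \<beta>)))\<^sup>2 / 8)"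
    using assms by (intro mult_mono divide_right_mono mult_left_mono) auto
  also have "\<dots> = 36 / 8 * A * K\<^sup>2 * (real N * (real N powr (\<beta> - 1))\<^sup>2 * (real N powr (1/2 - \<beta>))\<^sup>2)"
    by (simp add: power_mult_distrib)
  also have "real N * (real N powr (\<beta> - 1))\<^sup>2 * (real N powr (1/2 - \<beta>))\<^sup>2 = 1"
  proof -
    have "(real N powr (\<beta> - 1))\<^sup>2 * (real N powr (1/2 - \<beta>))\<^sup>2 = real N powr ((\<beta> - 1) + (\<beta> - 1) + ((1/2 - \<beta>) + (1/2 - \<beta>)))"
      by (simp only: power2_eq_square powr_add[symmetric])
    also have "(\<beta> - 1) + (\<beta> - 1) + ((1/2 - \<beta>) + (1/2 - \<beta>)) = - 1" by simp
    finally show ?thesis using N by (simp add: powr_minus mult.assoc)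
  qed
  also have "36 / 8 * A * K\<^sup>2 * 1 \<le> 5 * A * K\<^sup>2" using \<open>0 \<le> A\<close> by (simp add: mult_right_mono)
  finally show ?thesis .
qed

lemma merge_ratio_bound:
  assumes gp: "graph_property P" and "0 < \<beta>" "\<beta> \<le> 1/2" "0 < c2" "0 \<le> K" "0 < \<delta>" "\<delta> < 1"
    and sr: "\<And>n. n \<ge> n0 \<Longrightarrow> semi_random P n" and c2: "\<And>n. n \<ge> n0 \<Longrightarrow> rtime P n {#} \<le> c2 * real n"
    and lip: "\<And>n. n \<ge> n0 \<Longrightarrow> semi_random.lipschitz_const P n (K * real n powr (1/2 - \<beta>))"
    and merge: "\<forall>\<^sub>F n in sequentially. \<forall>i\<in>{1..n}. \<forall>G0.
           mgraph {1..n} G0 \<and> P {1..i} (induced G0 {1..i}) \<and> P {i+1..n} (induced G0 {i+1..n})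
           \<longrightarrow> (\<exists>S\<in>strategies n. expected_time P n G0 S \<le> ennreal (real n powr \<delta>))"
  obtains g n1 where "0 < g" "\<And>a b. a + b \<ge> n1 \<Longrightarrow> a + b \<le> 6 * a \<Longrightarrow> a + b \<le> 6 * b \<Longrightarrow>
      rtime P (a + b) {#} / real (a + b) \<le>
        max (rtime P a {#} / real a) (rtime P b {#} / real b) + 4 * real (a + b) powr (- g)"
proof -
  \<comment> \<open>Relative to N there are two losses: the slack
    \<open>N powr (1 - \<beta> / 2)\<close> in the horizon and the merging cost
    \<open>N powr \<delta>\<close>.\<close>
  define g where "g = min (\<beta> / 2) (1 - \<delta>)"
  have g: "0 < g" "g \<le> \<beta> / 2" "g \<le> 1 - \<delta>" "g \<le> 1"
    using \<open>0 < \<beta>\<close> \<open>\<beta> \<le> 1/2\<close> \<open>0 < \<delta>\<close> \<open>\<delta> < 1\<close> by (simp_all add: g_def min_def)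
  define E where "E = 5 * (c2 + 2) * K\<^sup>2"
  have "((\<lambda>n. 2 * exp E * c2 * (real n * exp (- (real n powr (\<beta> / 2))))) \<longlongrightarrow> 2 * exp E * c2 * 0) sequentially"
    using \<open>0 < \<beta>\<close> by (intro tendsto_mult tendsto_const) real_asymp
  then have "\<forall>\<^sub>F n in sequentially. 2 * exp E * c2 * (real n * exp (- (real n powr (\<beta> / 2)))) < 1"
    by (intro order_tendstoD) auto
  from eventually_conj[OF this merge]
  obtain n1 where n1: "\<And>N. N \<ge> n1 \<Longrightarrow> 2 * exp E * c2 * (real N * exp (- (real N powr (\<beta> / 2)))) < 1 \<and>
      (\<forall>i\<in>{1..N}. \<forall>G0. mgraph {1..N} G0 \<and> P {1..i} (induced G0 {1..i}) \<and> P {i+1..N} (induced G0 {i+1..N})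
           \<longrightarrow> (\<exists>S\<in>strategies N. expected_time P N G0 S \<le> ennreal (real N powr \<delta>)))"
    unfolding eventually_sequentially by (elim exE) (rule that, elim allE impE)
  \<comment> \<open>As each part has at least N/6 vertices, \<open>N \<ge> 6 * max n0 1\<close> puts
    both parts in the range where the bounds hold.\<close>
  have main: "rtime P N {#} / real N \<le> max (rtime P a {#} / real a) (rtime P b {#} / real b) + 4 * real N powr (- g)"
    if N: "N = a + b" "N \<ge> max n1 (6 * max n0 1)" "N \<le> 6 * a" "N \<le> 6 * b" for N a b
  proof -
    have ab: "a \<ge> n0" "b \<ge> n0" "N \<ge> n0" "a \<ge> 1" "b \<ge> 1" "N \<ge> 1" using N by auto
    then have pos: "real N > 0" "real a > 0" "real b > 0" by auto
    interpret N: semi_random P N by (intro sr ab)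
    interpret a: semi_random P a by (intro sr ab)
    interpret b: semi_random P b by (intro sr ab)
    define X where "X = max (rtime P a {#} / real a) (rtime P b {#} / real b)"
    have X: "0 \<le> X" "X \<le> c2"
      using c2[of a] c2[of b] ab pos a.rtime_nonneg by (auto simp: X_def divide_le_eq le_max_iff_disj)
    \<comment> \<open>The slack is o(N), yet multiplied by the tilt it gives
      \<open>N powr (\<beta> / 2)\<close>. The failure probability then beats the linear cost of
      starting over.\<close>
    let ?t = "real N powr (1 - \<beta> / 2)"
    define k where "k = nat \<lceil>real N * X + ?t\<rceil>"
    have "0 \<le> real N * X + ?t" using X by simp
    then have k: "real N * X + ?t \<le> real k" "real k \<le> real N * X + ?t + 1" unfolding k_def by linarith+
    have pw: "real N powr x \<le> real N powr y" if "x \<le> y" for x y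
      using that ab by (intro powr_mono) auto
    have "?t \<le> real N" using pw[of "1 - \<beta>/2" 1] \<open>0 < \<beta>\<close> by simp
    moreover have "real N * X \<le> real N * c2" using X by (intro mult_left_mono) auto
    moreover have "1 \<le> real N" using ab by simp
    moreover have "(c2 + 2) * real N = real N * c2 + 2 * real N" by (simp add: algebra_simps)
    ultimately have kN: "real k \<le> (c2 + 2) * real N" using k(2) by linarith
    let ?l = "real N powr (\<beta> - 1)"
    have tail: "exp (?l * (real N / real n * rtime P n {#} - real k)
        + real k * (?l\<^sup>2 * (real N / real n * (K * real n powr (1/2 - \<beta>)))\<^sup>2 / 8)) \<le> exp E * exp (- (real N powr (\<beta> / 2)))"
      if n: "n \<in> {a, b}" for n
    proof -
      have "rtime P n {#} / real n \<le> X" using n by (auto simp: X_def)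
      then have "real N / real n * rtime P n {#} \<le> real N * X"
        using pos mult_left_mono[of "rtime P n {#} / real n" X "real N"] by simp
      then have "real N / real n * rtime P n {#} - real k \<le> - ?t" using k(1) by simp
      then have "?l * (real N / real n * rtime P n {#} - real k) \<le> ?l * - ?t"
        by (intro mult_left_mono) auto
      also have "\<dots> = - (real N powr (\<beta> / 2))" by (simp add: powr_add[symmetric])
      finally have "?l * (real N / real n * rtime P n {#} - real k) \<le> - (real N powr (\<beta> / 2))" .
      moreover have "real k * (?l\<^sup>2 * (real N / real n * (K * real n powr (1/2 - \<beta>)))\<^sup>2 / 8) \<le> E"
        unfolding E_def using n N ab kN assms by (intro hoeffding_exponent_bound) auto
      ultimately show ?thesis unfolding exp_add[symmetric] by simp
    qed
    have "rtime P N {#} \<le> real k + real N powr \<delta> +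
      (exp (?l * (real N / real a * rtime P a {#} - real k) + real k * (?l\<^sup>2 * (real N / real a * (K * real a powr (1/2 - \<beta>)))\<^sup>2 / 8))
     + exp (?l * (real N / real b * rtime P b {#} - real k) + real k * (?l\<^sup>2 * (real N / real b * (K * real b powr (1/2 - \<beta>)))\<^sup>2 / 8))) * rtime P N {#}"
    proof (rule rtime_le_merge[OF N(1) gp _ _ _ lip lip])
      fix G assume G: "mgraph {1..N} G" "P {1..a} (induced G {1..a})" "P {a+1..N} (induced G {a+1..N})"
      have "a \<in> {1..N}" using ab N by auto
      moreover have "N \<ge> n1" using N(2) by simp
      ultimately obtain S where S: "S \<in> strategies N" "expected_time P N G S \<le> ennreal (real N powr \<delta>)"
        using conjunct2[OF n1, rule_format, of N a G] G by blast
      have "opt_time P N G \<le> expected_time P N G S" unfolding opt_time_def by (rule INF_lower[OF S(1)])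
      then show "rtime P N G \<le> real N powr \<delta>"
        unfolding rtime_def using S(2) by (intro enn2real_leI) auto
    qed (use ab sr in auto)
    also have "\<dots> \<le> real k + real N powr \<delta> +
        (exp E * exp (- (real N powr (\<beta> / 2))) + exp E * exp (- (real N powr (\<beta> / 2)))) * (c2 * real N)"
      using c2[OF ab(3)] tail by (intro add_left_mono mult_mono add_mono N.rtime_nonneg) auto
    also have "\<dots> = real k + real N powr \<delta> + 2 * exp E * c2 * (real N * exp (- (real N powr (\<beta> / 2))))"
      by simp
    also have "\<dots> \<le> real N * X + ?t + 1 + real N powr \<delta> + 1"
      using k(2) n1[of N] N(2) by simp
    \<comment> \<open>Four terms are absorbed: the slack, the rounding of \<open>k\<close>, the
      merging, and the expected cost of failure.\<close>
    also have "\<dots> \<le> real N * X + 4 * real N powr (1 - g)"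
      using pw[of "1 - \<beta>/2" "1 - g"] pw[of \<delta> "1 - g"] pw[of 0 "1 - g"] g pos by simp
    also have "\<dots> = real N * (X + 4 * real N powr (- g))"
      using pos by (simp add: powr_diff powr_minus field_simps)
    finally show ?thesis unfolding X_def[symmetric] using pos by (simp add: divide_le_eq mult.commute)
  qed
  show ?thesis by (rule that[of g "max n1 (6 * max n0 1)", OF g(1)], rule main[OF refl])
qed

lemma optimal_ratio_converges:
  assumes "graph_property P" "0 < \<beta>" "\<beta> \<le> 1/2" "0 < c1" "0 < c2" "0 \<le> K" "0 < \<delta>" "\<delta> < 1"
    and sr: "\<And>n. n \<ge> n0 \<Longrightarrow> semi_random P n"
    and c1: "\<And>n. n \<ge> n0 \<Longrightarrow> c1 * real n \<le> rtime P n {#}"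
    and c2: "\<And>n. n \<ge> n0 \<Longrightarrow> rtime P n {#} \<le> c2 * real n"
    and lip: "\<And>n. n \<ge> n0 \<Longrightarrow> semi_random.lipschitz_const P n (K * real n powr (1/2 - \<beta>))"
    and merge: "\<forall>\<^sub>F n in sequentially. \<forall>i\<in>{1..n}. \<forall>G0.
           mgraph {1..n} G0 \<and> P {1..i} (induced G0 {1..i}) \<and> P {i+1..n} (induced G0 {i+1..n})
           \<longrightarrow> (\<exists>S\<in>strategies n. expected_time P n G0 S \<le> ennreal (real n powr \<delta>))"
    and smooth: "\<forall>\<^sub>F n in sequentially. \<bar>rtime P n {#} - rtime P (n + 1) {#}\<bar> < real n powr \<delta>"
  obtains C where "C > 0" "(\<lambda>n. rtime P n {#} / real n) \<longlonglongrightarrow> C"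
proof -
  let ?f = "\<lambda>n. rtime P n {#} / real n"
  obtain g n1 where "0 < g" and n1: "\<And>a b. a + b \<ge> n1 \<Longrightarrow> a + b \<le> 6 * a \<Longrightarrow> a + b \<le> 6 * b \<Longrightarrow>
      ?f (a + b) \<le> max (?f a) (?f b) + 4 * real (a + b) powr (- g)"
    using merge_ratio_bound[OF assms(1-3,5-8) sr c2 lip merge] by blast
  obtain n2 where n2: "\<And>n. n \<ge> n2 \<Longrightarrow> \<bar>rtime P n {#} - rtime P (n + 1) {#}\<bar> < real n powr \<delta>"
    using smooth unfolding eventually_sequentially by blast
  have "convergent ?f"
  proof (rule convergent_of_merge[OF \<open>0 < g\<close>, of 4 "max n1 (max n2 1)" ?f "\<lambda>n. real n powr (\<delta> - 1)"])
    show "0 \<le> ?f m" for m by (simp add: rtime_def)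
    show "(\<lambda>n. real n powr (\<delta> - 1)) \<longlonglongrightarrow> 0"
      using \<open>\<delta> < 1\<close> by (intro tendsto_neg_powr filterlim_real_sequentially) simp
    fix m assume m: "m \<ge> max n1 (max n2 1)"
    have "?f (m + 1) \<le> (rtime P m {#} + real m powr \<delta>) / real (m + 1)"
      using n2[of m] m by (intro divide_right_mono) auto
    also have "\<dots> \<le> (rtime P m {#} + real m powr \<delta>) / real m"
      using m by (intro divide_left_mono) (auto simp: rtime_def)
    also have "\<dots> = ?f m + real m powr (\<delta> - 1)" using m by (simp add: add_divide_distrib powr_diff)
    finally show "?f (m + 1) \<le> ?f m + real m powr (\<delta> - 1)" .
  qed (use n1 in auto)
  then obtain C where C: "?f \<longlonglongrightarrow> C" unfolding convergent_def by blast
  \<comment> \<open>Linearity makes the limit positive, so that a relative error \<epsilon> in the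
    threshold leaves room of order n for concentration.\<close>
  have "c1 \<le> C"
  proof (rule tendsto_lowerbound[OF C])
    show "\<forall>\<^sub>F n in sequentially. c1 \<le> ?f n"
      using eventually_ge_at_top[of "max n0 1"] by eventually_elim (use c1 in \<open>auto simp: le_divide_eq\<close>)
  qed simp
  then show ?thesis using \<open>0 < c1\<close> by (intro that[OF _ C]) simp
qed

lemma exp_neg_powr_tendsto_0:
  fixes d \<beta> :: real
  assumes "0 < d" "0 < \<beta>"
  shows "(\<lambda>n. exp (- d * real n powr \<beta>)) \<longlonglongrightarrow> 0"
  using assms by real_asymp

text \<open>Half of the window \<open>\<epsilon> * C * n\<close> covers the distance of the expected
  time from \<open>C * n\<close>; the other half is the deviation fed into the two tail
  bounds.\<close>

lemma sharp_threshold_of_ratio_limit: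
  assumes "graph_property P" "0 < \<beta>" "\<beta> \<le> 1/2" "0 \<le> K" "C > 0"
    and sr: "\<And>n. n \<ge> n0 \<Longrightarrow> semi_random P n"
    and lip: "\<And>n. n \<ge> n0 \<Longrightarrow> semi_random.lipschitz_const P n (K * real n powr (1/2 - \<beta>))"
    and lim: "(\<lambda>n. rtime P n {#} / real n) \<longlonglongrightarrow> C"
  shows "sharp_threshold P (\<lambda>n. C * real n)"
  unfolding sharp_threshold_def
proof (intro allI impI conjI)
  fix \<epsilon> :: real assume "\<epsilon> > 0"
  then have eC: "\<epsilon> * C / 2 > 0" using \<open>C > 0\<close> by simp
  define E where "E = 5 * ((1 + \<epsilon>) * C) * K\<^sup>2"
  let ?r = "\<lambda>n. rtime P n {#}" and ?l = "\<lambda>n. real n powr (\<beta> - 1)"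
  have "\<forall>\<^sub>F n in sequentially. dist (?r n / real n) C < \<epsilon> * C / 2" by (rule tendstoD[OF lim eC])
  then have ev: "\<forall>\<^sub>F n in sequentially. n \<ge> n0 \<and> n \<ge> 1 \<and> \<bar>?r n - C * real n\<bar> \<le> \<epsilon> * C / 2 * real n"
    using eventually_ge_at_top[of "max n0 1"]
  proof eventually_elim
    case (elim n)
    then have "real n > 0" by auto
    have "?r n - C * real n = (?r n / real n - C) * real n"
      using \<open>real n > 0\<close> by (simp add: left_diff_distrib)
    then have "\<bar>?r n - C * real n\<bar> = \<bar>?r n / real n - C\<bar> * real n" by (simp add: abs_mult)
    also have "\<dots> \<le> \<epsilon> * C / 2 * real n" using elim(1) by (intro mult_right_mono) (auto simp: dist_real_def)
    finally show ?case using elim by simp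
  qed
  have bnd: "real k * ((?l n)\<^sup>2 * (K * real n powr (1/2 - \<beta>))\<^sup>2 / 8) \<le> E"
    if "n \<ge> 1" "real k \<le> (1 + \<epsilon>) * C * real n" for n k
    using hoeffding_exponent_bound[of n n \<beta> K "real k" "(1 + \<epsilon>) * C"] that assms unfolding E_def by simp
  have ln: "?l n * real n = real n powr \<beta>" if "n \<ge> 1" for n
    using that by (simp add: powr_diff)
  define k where "k n = nat \<lfloor>(1 + \<epsilon>) * (C * real n)\<rfloor>" for n
  have k: "real (k n) \<le> (1 + \<epsilon>) * (C * real n)" "(1 + \<epsilon>) * (C * real n) - 1 \<le> real (k n)" for n
  proof -
    have "0 \<le> (1 + \<epsilon>) * (C * real n)" using \<open>\<epsilon> > 0\<close> \<open>C > 0\<close> by simp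
    then show "real (k n) \<le> (1 + \<epsilon>) * (C * real n)" "(1 + \<epsilon>) * (C * real n) - 1 \<le> real (k n)"
      unfolding k_def by linarith+
  qed
  show "\<exists>S. (\<forall>n. S n \<in> strategies n) \<and> (\<lambda>n. prob_within P n {#} (S n) ((1 + \<epsilon>) * (C * real n))) \<longlonglongrightarrow> 1"
  proof -
    have "\<exists>S\<in>strategies n. n \<ge> 1 \<longrightarrow> prob_within P n {#} S (real (k n)) = win (P {1..n}) n (k n) {#}" for n
    proof (cases "n \<ge> 1")
      case True
      then show ?thesis using win_attained[of n P "{#}" "k n"] by blast
    next
      case False
      \<comment> \<open>For n = 0 there are no squares, so every function is a strategy; one is
        chosen only to make the family total.\<close>
      then have "(\<lambda>_. 0) \<in> strategies n" unfolding strategies_def by auto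
      then show ?thesis using False by blast
    qed
    then obtain S where S: "\<And>n. S n \<in> strategies n"
      "\<And>n. n \<ge> 1 \<Longrightarrow> prob_within P n {#} (S n) (real (k n)) = win (P {1..n}) n (k n) {#}" by metis
    have "(\<lambda>n. prob_within P n {#} (S n) ((1 + \<epsilon>) * (C * real n))) \<longlonglongrightarrow> 1"
    proof (rule tendsto_sandwich[where h="\<lambda>_. 1"])
      show "\<forall>\<^sub>F n in sequentially. 1 - exp (1 + E) * exp (- (\<epsilon> * C / 2) * real n powr \<beta>) \<le> prob_within P n {#} (S n) ((1 + \<epsilon>) * (C * real n))"
        using ev
      proof eventually_elim
        case (elim n)
        then interpret semi_random P n by (intro sr) simp
        \<comment> \<open>Rounding down the horizon loses one step, hence at most 1 in the exponent;
          this is the 1 in \<open>exp (1 + E)\<close>.\<close>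
        have "?l n \<le> 1" using elim \<open>\<beta> \<le> 1/2\<close> powr_mono[of "\<beta> - 1" 0 "real n"] by simp
        have "?r n - C * real n \<le> \<epsilon> * C / 2 * real n" using elim by (blast dest: abs_le_D1)
        then have "?r n - real (k n) \<le> - (\<epsilon> * C / 2) * real n + 1"
          using k(2)[of n] by (simp add: algebra_simps)
        then have "?l n * (?r n - real (k n)) \<le> ?l n * (- (\<epsilon> * C / 2) * real n + 1)"
          by (intro mult_left_mono) auto
        also have "\<dots> = - (\<epsilon> * C / 2) * (?l n * real n) + ?l n" by (simp add: algebra_simps)
        also have "\<dots> \<le> - (\<epsilon> * C / 2) * real n powr \<beta> + 1" using elim ln[of n] \<open>?l n \<le> 1\<close> by simp
        finally have 1: "?l n * (?r n - real (k n)) \<le> - (\<epsilon> * C / 2) * real n powr \<beta> + 1" .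
        have "1 - win (P {1..n}) n (k n) {#} \<le>
          exp (?l n * (?r n - real (k n)) + real (k n) * ((?l n)\<^sup>2 * (K * real n powr (1/2 - \<beta>))\<^sup>2 / 8))"
          using elim by (intro one_minus_win_le_exp assms(1) lip) auto
        also have "\<dots> \<le> exp ((1 + E) + (- (\<epsilon> * C / 2) * real n powr \<beta>))"
          using 1 bnd[of n "k n"] k(1)[of n] elim by (simp add: mult.assoc)
        finally have "1 - win (P {1..n}) n (k n) {#} \<le> exp (1 + E) * exp (- (\<epsilon> * C / 2) * real n powr \<beta>)"
          by (simp only: exp_add)
        moreover have "prob_within P n {#} (S n) (real (k n)) \<le> prob_within P n {#} (S n) ((1 + \<epsilon>) * (C * real n))"
          by (rule prob_within_mono[OF k(1)])
        ultimately show ?case using S(2)[of n] elim by simp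
      qed
      have "((\<lambda>n. exp (- (\<epsilon> * C / 2) * real n powr \<beta>)) \<longlongrightarrow> 0) sequentially"
        by (rule exp_neg_powr_tendsto_0[OF eC \<open>0 < \<beta>\<close>])
      then have "(\<lambda>n. 1 - exp (1 + E) * exp (- (\<epsilon> * C / 2) * real n powr \<beta>)) \<longlonglongrightarrow> 1 - exp (1 + E) * 0"
        by (intro tendsto_diff tendsto_mult tendsto_const)
      then show "(\<lambda>n. 1 - exp (1 + E) * exp (- (\<epsilon> * C / 2) * real n powr \<beta>)) \<longlonglongrightarrow> 1" by simp
    qed (simp_all add: prob_within_bounds)
    then show ?thesis using S(1) by blast
  qed
  fix S assume S: "\<forall>n. S n \<in> strategies n"
  show "(\<lambda>n. prob_within P n {#} (S n) ((1 - \<epsilon>) * (C * real n))) \<longlonglongrightarrow> 0"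
  proof (rule tendsto_sandwich[where f="\<lambda>_. 0"])
    show "\<forall>\<^sub>F n in sequentially. prob_within P n {#} (S n) ((1 - \<epsilon>) * (C * real n)) \<le> exp E * exp (- (\<epsilon> * C / 2) * real n powr \<beta>)"
      using ev
    proof eventually_elim
      case (elim n)
      then interpret semi_random P n by (intro sr) simp
      show ?case
      \<comment> \<open>For \<epsilon> > 1 the time bound is negative and the probability is
        0.\<close>
      proof (cases "(1 - \<epsilon>) * (C * real n) < 0")
        case True
        then show ?thesis by (simp add: prob_within_neg)
      next
        case False
        let ?k = "nat \<lfloor>(1 - \<epsilon>) * (C * real n)\<rfloor>"
        have k': "real ?k \<le> (1 - \<epsilon>) * (C * real n)" using False by linarith
        have "0 \<le> \<epsilon> * (C * real n)" using \<open>\<epsilon> > 0\<close> \<open>C > 0\<close> by simp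
        then have k'': "real ?k \<le> (1 + \<epsilon>) * C * real n" using k' by (simp add: algebra_simps)
        have "- (?r n - C * real n) \<le> \<epsilon> * C / 2 * real n" using elim by (blast dest: abs_le_D2)
        then have "\<epsilon> * C / 2 * real n \<le> ?r n - real ?k"
          using k' by (simp add: algebra_simps)
        then have "?l n * (\<epsilon> * C / 2 * real n) \<le> ?l n * (?r n - real ?k)"
          by (intro mult_left_mono) auto
        then have 1: "- ?l n * (?r n - real ?k) \<le> - (\<epsilon> * C / 2) * real n powr \<beta>"
          using ln[of n] elim by (simp add: algebra_simps)
        have "prob_within P n {#} (S n) ((1 - \<epsilon>) * (C * real n)) = prob_within P n {#} (S n) (real ?k)"
          using False by (intro prob_within_floor) simp
        also have "\<dots> \<le> win (P {1..n}) n ?k {#}" using S by (intro prob_within_le_win n) auto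
        also have "\<dots> \<le> exp (- ?l n * (?r n - real ?k) + real ?k * ((?l n)\<^sup>2 * (K * real n powr (1/2 - \<beta>))\<^sup>2 / 8))"
          using elim by (intro win_le_exp lip) (auto simp: mgraph_def)
        also have "\<dots> \<le> exp (E + (- (\<epsilon> * C / 2) * real n powr \<beta>))"
        proof -
          have "real ?k * ((?l n)\<^sup>2 * (K * real n powr (1/2 - \<beta>))\<^sup>2 / 8) \<le> E"
            using elim by (intro bnd k'') simp
          then show ?thesis using 1 by simp
        qed
        finally show ?thesis by (simp only: exp_add)
      qed
    qed
    have "((\<lambda>n. exp (- (\<epsilon> * C / 2) * real n powr \<beta>)) \<longlongrightarrow> 0) sequentially"
      by (rule exp_neg_powr_tendsto_0[OF eC \<open>0 < \<beta>\<close>])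
    then have "(\<lambda>n. exp E * exp (- (\<epsilon> * C / 2) * real n powr \<beta>)) \<longlonglongrightarrow> exp E * 0"
      by (intro tendsto_mult tendsto_const)
    then show "(\<lambda>n. exp E * exp (- (\<epsilon> * C / 2) * real n powr \<beta>)) \<longlonglongrightarrow> 0" by simp
  qed (simp_all add: prob_within_bounds)
qed

theorem theorem4p3:
  fixes P :: property and \<alpha> \<delta> :: real
  assumes "graph_property P"
    and "\<alpha> > 0"
    and "edge_replaceable (\<lambda>n. real n powr \<alpha>) P"
    and "linear_property P"
    and "monotone_increasing P"
    and "0 < \<delta>" and "\<delta> < 1"
    and merge: "\<forall>\<^sub>F n in sequentially. \<forall>i\<in>{1..n}. \<forall>G0.
           mgraph {1..n} G0 \<and> P {1..i} (induced G0 {1..i}) \<and> P {i+1..n} (induced G0 {i+1..n})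
           \<longrightarrow> (\<exists>S\<in>strategies n. expected_time P n G0 S \<le> ennreal (real n powr \<delta>))"
    and "\<forall>\<^sub>F n in sequentially.
           \<bar>enn2real (optimal_time P n) - enn2real (optimal_time P (n + 1))\<bar> < real n powr \<delta>"
  shows "\<exists>C. (\<lambda>n. enn2real (optimal_time P n) / real n) \<longlonglongrightarrow> C \<and>
             sharp_threshold P (\<lambda>n. C * real n)"
proof (rule linear_replaceable_bounds[OF assms(2-5)])
  have I: "enn2real (optimal_time P n) = rtime P n {#}" for n
    by (simp add: rtime_def optimal_time_eq)
  fix \<beta> c1 c2 K :: real and n0 :: nat
  assume bounds: "0 < \<beta>" "\<beta> \<le> 1/2" "0 < c1" "0 < c2" "0 \<le> K"
    "\<And>n. n \<ge> n0 \<Longrightarrow> semi_random P n"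
    "\<And>n. n \<ge> n0 \<Longrightarrow> c1 * real n \<le> rtime P n {#}"
    "\<And>n. n \<ge> n0 \<Longrightarrow> rtime P n {#} \<le> c2 * real n"
    "\<And>n. n \<ge> n0 \<Longrightarrow> semi_random.lipschitz_const P n (K * real n powr (1/2 - \<beta>))"
  show ?thesis
  proof (rule optimal_ratio_converges[OF assms(1) bounds(1-5) assms(6,7) bounds(6-9) merge assms(9)[unfolded I]])
    fix C assume "C > 0" and C: "(\<lambda>n. rtime P n {#} / real n) \<longlonglongrightarrow> C"
    have "sharp_threshold P (\<lambda>n. C * real n)"
      by (rule sharp_threshold_of_ratio_limit[OF assms(1) bounds(1,2,5) \<open>C > 0\<close> bounds(6,9) C])
    then show ?thesis using C unfolding I by blast
  qed
qed

end
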